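(* Let $n$ be even and let $H_n$ be a graph on $n$ vertices with minimum degree at least $n/2-\eta$. If $\eta=\eta(n)=o(n)$ with $\eta=\omega(1)$, $\lambda=\lambda(n)=\omega(\eta^{1/2})$ and $m\geq4\eta+\lambda$, then a.a.s. $H_n\cup G_{n,m}$ contains a perfect matching.
   Context: All graphs are simple; $H_n$ denotes a sequence of graphs indexed by even $n$. For an integer $m\in[\binom{n}{2}]$, $G_{n,m}$ is the random graph on the same $n$-vertex set as $H_n$ having exactly $m$ edges, chosen uniformly at random among all such graphs; $H_n\cup G_{n,m}$ is the union of edge sets. A perfect matching is a set of $n/2$ pairwise disjoint edges. An event holds asymptotically almost surely (a.a.s.) if its probability tends to $1$ as $n\to\infty$. Asymptotic notation is as $n\to\infty$. *)

theory Defs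
  imports "HOL-Probability.Probability" "HOL-Library.Ramsey" "HOL-Library.Landau_Symbols"
begin

text \<open>
  A graph is represented by a vertex set \<open>V\<close> together with a set of edges, each edge being a
  two-element subset of \<open>V\<close>.
\<close>

definition simple_graph :: "'a set \<Rightarrow> 'a set set \<Rightarrow> bool" where
  "simple_graph V E \<longleftrightarrow> finite V \<and> E \<subseteq> nsets V 2"

definition vertex_degree :: "'a set set \<Rightarrow> 'a \<Rightarrow> nat" where
  "vertex_degree E v = card {e \<in> E. v \<in> e}"

definition min_degree :: "'a set \<Rightarrow> 'a set set \<Rightarrow> nat" where
  "min_degree V E = Min (vertex_degree E ` V)"

definition perfect_matching :: "'a set \<Rightarrow> 'a set set \<Rightarrow> 'a set set \<Rightarrow> bool" where
  "perfect_matching V E M \<longleftrightarrow> M \<subseteq> E \<and> pairwise disjnt M \<and> 2 * card M = card V"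

text \<open>
  The uniform distribution on the edge sets of size \<open>m\<close>; it is meaningful only for
  \<open>m \<le> card V choose 2\<close>, as otherwise there is no such edge set.
\<close>

definition uniform_random_graph :: "'a set \<Rightarrow> nat \<Rightarrow> 'a set set pmf" where
  "uniform_random_graph V m = pmf_of_set {E. E \<subseteq> nsets V 2 \<and> card E = m}"

definition even_at_top :: "nat filter" where
  "even_at_top = inf at_top (principal {n. even n})"

end

theory Submission
  imports Defs
begin

text \<open>
  A maximum matching of \<open>H\<close> that is not perfect has no augmenting path with at most five edges. For two
  unmatched vertices, the mates of their neighbours therefore form two sets of at least \<open>n/2 - \<eta>\<close>
  vertices with no edge in between. If these sets are disjoint, \<open>H\<close> is close to two disjoint cliques
  and any edge across yields a perfect matching. Otherwise they share an independent set of almost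
  \<open>n/2\<close> vertices and \<open>H\<close> is close to a complete bipartite graph, so that it suffices to find
  a matching of \<open>a \<le> \<eta>\<close> edges of the random graph inside a set \<open>U\<close> with about \<open>n/2 + a\<close> vertices.

  Adding the random edges one at a time and keeping every edge between two free vertices of \<open>U\<close> needs
  \<open>4\<eta> + \<Theta>(\<eta>\<^sup>3/n\<^sup>2)\<close> steps on average, which is too slow if \<open>\<eta>\<close> is much larger than \<open>n\<^bsup>4/5\<^esup>\<close>. One therefore
  also keeps track of the paths with two edges, either end of which can be left unmatched. This gains
  more than the third-order term, and an exponential potential function shows that
  \<open>4\<eta> + K \<surd>\<eta>\<close> steps fail with probability at most \<open>exp (25 - K/4)\<close>.
\<close>

section \<open>Adding random edges one at a time\<close>

text \<open>Write \<open>e = a/n\<close> and \<open>x = k/n\<close> when \<open>k\<close> edges have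
  been found. A greedy draw succeeds with probability about \<open>f^2\<close>, where
  \<open>f = 1/2 + e - 2 * x\<close>, and the integral of \<open>1 / f^2\<close> over
  \<open>x\<close> from 0 to \<open>e\<close> is \<open>4 * e / (1 - 4 * e^2)\<close>. The surplus
  of free vertices at the start and the shortage at the end cancel to first order, so the leading
  constant 4 is already there; only the convexity of \<open>1 / f^2\<close> is left, and cherries
  have to win back no more than an amount of order \<open>e^3\<close>. The larger side of the
  bipartition may exceed n/2 by some \<open>s' = \<eta> + d\<close> with \<open>d > 0\<close>. The
  minimum degree then forces edges inside it: H has a matching there with about \<open>2 * d\<close>
  edges, so at most about \<open>\<eta> - d\<close> edges remain to be drawn. The vertices it covers
  make \<open>U\<close> smaller than \<open>n/2 + a\<close> by only about \<open>2 * d\<close>, and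
  the resulting relative loss of order \<open>d/n\<close> in the success probability costs far fewer
  draws than the \<open>4 * d\<close> that are saved.\<close>

primrec failure_prob :: "'b set \<Rightarrow> ('b set \<Rightarrow> bool) \<Rightarrow> nat \<Rightarrow> 'b set \<Rightarrow> real" where
  "failure_prob \<Omega> Q 0 E = (if Q E then 0 else 1)"
| "failure_prob \<Omega> Q (Suc t) E =
     (\<Sum>e\<in>\<Omega> - E. failure_prob \<Omega> Q t (insert e E)) / real (card (\<Omega> - E))"

lemma failure_prob_nonneg: "0 \<le> failure_prob \<Omega> Q t E"
  by (induction t arbitrary: E) (auto intro!: divide_nonneg_nonneg sum_nonneg)

text \<open>Both sides count the sets \<open>Y\<close> of size \<open>Suc t\<close> satisfying
  \<open>S\<close> together with a distinguished element \<open>e\<close> of \<open>Y\<close>, where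
  \<open>X = Y - {e}\<close>.\<close>

lemma sum_card_remove_elem:
  assumes "finite R"
  shows "(\<Sum>e\<in>R. card {X. X \<subseteq> R - {e} \<and> card X = t \<and> S (insert e X)})
       = Suc t * card {Y. Y \<subseteq> R \<and> card Y = Suc t \<and> S Y}"
proof -
  define B where "B = {Y. Y \<subseteq> R \<and> card Y = Suc t \<and> S Y}"
  define C where "C e = {X. X \<subseteq> R - {e} \<and> card X = t \<and> S (insert e X)}" for e
  have finB: "finite B"
    unfolding B_def by (rule finite_subset[of _ "Pow R"]) (use assms in auto)
  have finC: "finite (C e)" for e
    unfolding C_def by (rule finite_subset[of _ "Pow R"]) (use assms in auto)
  have finY: "finite Y" if "Y \<in> B" for Y
    using that assms finite_subset unfolding B_def by auto
  have "(\<Sum>e\<in>R. card (C e)) = card (SIGMA e:R. C e)"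
    using assms finC by (simp add: card_SigmaI)
  also have "\<dots> = card (SIGMA Y:B. Y)"
  proof (rule bij_betw_same_card[of "\<lambda>(e, X). (insert e X, e)"],
      rule bij_betw_byWitness[where f' = "\<lambda>(Y, e). (e, Y - {e})"])
    show "\<forall>p\<in>SIGMA e:R. C e. (\<lambda>(Y, e). (e, Y - {e})) ((\<lambda>(e, X). (insert e X, e)) p) = p"
      by (auto simp: C_def)
    show "\<forall>p\<in>SIGMA Y:B. Y. (\<lambda>(e, X). (insert e X, e)) ((\<lambda>(Y, e). (e, Y - {e})) p) = p"
      by auto
    show "(\<lambda>(e, X). (insert e X, e)) ` (SIGMA e:R. C e) \<subseteq> (SIGMA Y:B. Y)"
    proof clarsimp
      fix e X assume "e \<in> R" and X: "X \<in> C e"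
      moreover have "finite X" "e \<notin> X"
        using X assms finite_subset[of X "R - {e}"] by (auto simp: C_def)
      ultimately show "insert e X \<in> B"
        by (auto simp: C_def B_def)
    qed
    show "(\<lambda>(Y, e). (e, Y - {e})) ` (SIGMA Y:B. Y) \<subseteq> (SIGMA e:R. C e)"
      using finY by (auto simp: C_def B_def insert_absorb card_Diff_singleton)
  qed
  also have "\<dots> = (\<Sum>Y\<in>B. card Y)"
    using finB finY by (simp add: card_SigmaI)
  also have "\<dots> = (\<Sum>Y\<in>B. Suc t)"
    by (rule sum.cong) (auto simp: B_def)
  finally show ?thesis
    by (simp add: B_def C_def)
qed

text \<open>Successive draws without replacement produce a uniformly random \<open>t\<close>-set,
  every set arising from equally many orders. In the induction this becomes the absorption identity
  for binomial coefficients. The bound on \<open>t\<close> keeps the drawing from running out of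
  elements.\<close>

lemma failure_prob_eq_card:
  assumes "finite \<Omega>" "E \<subseteq> \<Omega>" "t \<le> card (\<Omega> - E)"
  shows "failure_prob \<Omega> Q t E * real (card (\<Omega> - E) choose t)
       = real (card {X. X \<subseteq> \<Omega> - E \<and> card X = t \<and> \<not> Q (E \<union> X)})"
  using assms(2,3)
proof (induction t arbitrary: E)
  case 0
  have "(X \<subseteq> \<Omega> - E \<and> card X = 0 \<and> \<not> Q (E \<union> X)) = (X = {} \<and> \<not> Q E)" for X
    using assms(1) finite_subset[of X "\<Omega> - E"] by (cases "X = {}") auto
  then have "{X. X \<subseteq> \<Omega> - E \<and> card X = 0 \<and> \<not> Q (E \<union> X)} = (if Q E then {} else {{}})"
    by (simp only:) auto
  then show ?case by simp
next
  case (Suc t)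
  define R where "R = \<Omega> - E"
  define r where "r = card R"
  have finR: "finite R" and r: "Suc t \<le> r"
    using assms(1) Suc.prems by (auto simp: R_def r_def)
  have IH: "failure_prob \<Omega> Q t (insert e E) * real ((r - 1) choose t)
      = real (card {X. X \<subseteq> R - {e} \<and> card X = t \<and> \<not> Q (E \<union> insert e X)})" if "e \<in> R" for e
  proof -
    have *: "\<Omega> - insert e E = R - {e}" by (auto simp: R_def)
    have "card (R - {e}) = r - 1" using that finR by (simp add: r_def)
    then show ?thesis
      using Suc.IH[of "insert e E"] that Suc.prems r unfolding * by (auto simp: R_def)
  qed
  have "real r * (failure_prob \<Omega> Q (Suc t) E * real ((r - 1) choose t))
      = (\<Sum>e\<in>R. failure_prob \<Omega> Q t (insert e E) * real ((r - 1) choose t))"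
    using r by (simp add: R_def[symmetric] r_def[symmetric] sum_distrib_right)
  also have "\<dots> = real (\<Sum>e\<in>R. card {X. X \<subseteq> R - {e} \<and> card X = t \<and> \<not> Q (E \<union> insert e X)})"
    using IH by simp
  also have "\<dots> = real (Suc t) * real (card {Y. Y \<subseteq> R \<and> card Y = Suc t \<and> \<not> Q (E \<union> Y)})"
    by (subst sum_card_remove_elem[OF finR, of t "\<lambda>Y. \<not> Q (E \<union> Y)"])
      (simp only: of_nat_mult)
  finally have 1: "real r * (failure_prob \<Omega> Q (Suc t) E * real ((r - 1) choose t))
      = real (Suc t) * real (card {Y. Y \<subseteq> R \<and> card Y = Suc t \<and> \<not> Q (E \<union> Y)})" .
  have "Suc t * (r choose Suc t) = r * ((r - 1) choose t)"
    by (rule binomial_absorption)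
  then have "real (Suc t) * real (r choose Suc t) = real r * real ((r - 1) choose t)"
    by (metis of_nat_mult)
  then have "real (Suc t) * (failure_prob \<Omega> Q (Suc t) E * real (r choose Suc t))
    = real (Suc t) * real (card {Y. Y \<subseteq> R \<and> card Y = Suc t \<and> \<not> Q (E \<union> Y)})"
    using 1 by (metis mult.assoc mult.left_commute)
  then have "failure_prob \<Omega> Q (Suc t) E * real (r choose Suc t)
    = real (card {Y. Y \<subseteq> R \<and> card Y = Suc t \<and> \<not> Q (E \<union> Y)})"
    by (simp only: mult_cancel_left) simp
  then show ?case by (simp only: R_def r_def)
qed

lemma failure_prob_Suc_le:
  assumes fin: "finite \<Omega>" and "E \<subseteq> \<Omega>"
    and up: "\<And>E e. E \<subseteq> \<Omega> \<Longrightarrow> e \<in> \<Omega> \<Longrightarrow> Q E \<Longrightarrow> Q (insert e E)"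
  shows "failure_prob \<Omega> Q (Suc t) E \<le> failure_prob \<Omega> Q t E"
  using assms(2)
proof (induction t arbitrary: E)
  case 0
  have "(\<Sum>e\<in>\<Omega> - E. failure_prob \<Omega> Q 0 (insert e E)) \<le> (\<Sum>e\<in>\<Omega> - E. failure_prob \<Omega> Q 0 E)"
    using up 0 by (intro sum_mono) auto
  \<comment> \<open>If no element is left to draw, the quotient is 0 by convention, so an exhausted
    process counts as successful; this agrees with the direction of the inequality.\<close>
  then show ?case
    by (cases "card (\<Omega> - E) = 0") (auto simp: divide_simps mult.commute simp del: card_0_eq)
next
  case (Suc t)
  have "(\<Sum>e\<in>\<Omega> - E. failure_prob \<Omega> Q (Suc t) (insert e E))
      \<le> (\<Sum>e\<in>\<Omega> - E. failure_prob \<Omega> Q t (insert e E))"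
    using Suc.prems by (intro sum_mono Suc.IH) auto
  then show ?case
    by (subst (1 2) failure_prob.simps(2)) (rule divide_right_mono, auto)
qed

lemma failure_prob_antimono:
  assumes "finite \<Omega>" "E \<subseteq> \<Omega>"
    and "\<And>E e. E \<subseteq> \<Omega> \<Longrightarrow> e \<in> \<Omega> \<Longrightarrow> Q E \<Longrightarrow> Q (insert e E)"
    and "s \<le> t"
  shows "failure_prob \<Omega> Q t E \<le> failure_prob \<Omega> Q s E"
  by (rule lift_Suc_antimono_le[of "\<lambda>t. failure_prob \<Omega> Q t E"], rule failure_prob_Suc_le)
    (use assms in auto)

lemma failure_prob_success:
  assumes "finite \<Omega>" "E \<subseteq> \<Omega>"
    and "\<And>E e. E \<subseteq> \<Omega> \<Longrightarrow> e \<in> \<Omega> \<Longrightarrow> Q E \<Longrightarrow> Q (insert e E)" and "Q E"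
  shows "failure_prob \<Omega> Q t E = 0"
proof -
  have "failure_prob \<Omega> Q t E \<le> failure_prob \<Omega> Q 0 E"
    by (rule failure_prob_antimono) (use assms in auto)
  then show ?thesis
    using failure_prob_nonneg[of \<Omega> Q t E] assms(4) by simp
qed

text \<open>Drawing with replacement can only waste steps.\<close>

lemma failure_prob_le_replacement:
  assumes fin: "finite \<Omega>" and E: "E \<subseteq> \<Omega>"
    and up: "\<And>E e. E \<subseteq> \<Omega> \<Longrightarrow> e \<in> \<Omega> \<Longrightarrow> Q E \<Longrightarrow> Q (insert e E)"
  shows "failure_prob \<Omega> Q (Suc t) E
       \<le> (\<Sum>e\<in>\<Omega>. failure_prob \<Omega> Q t (insert e E)) / real (card \<Omega>)"
proof (cases "E = \<Omega>")
  case True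
  then show ?thesis
    by (auto intro!: divide_nonneg_nonneg sum_nonneg failure_prob_nonneg)
next
  case False
  define S where "S = (\<Sum>e\<in>\<Omega> - E. failure_prob \<Omega> Q t (insert e E))"
  define F where "F = failure_prob \<Omega> Q t E"
  have finE: "finite E" using fin E finite_subset by blast
  have pos: "0 < real (card (\<Omega> - E))"
  proof -
    have "\<Omega> - E \<noteq> {}" using False E by blast
    then show ?thesis using fin by (simp add: card_gt_0_iff)
  qed
  have tot: "real (card \<Omega>) = real (card (\<Omega> - E)) + real (card E)"
    using E fin finE by (simp add: card_Diff_subset card_mono of_nat_diff)
  have "(\<Sum>e\<in>\<Omega>. failure_prob \<Omega> Q t (insert e E)) = S + (\<Sum>e\<in>E. failure_prob \<Omega> Q t (insert e E))"
    unfolding S_def by (rule sum.subset_diff) (use E fin in auto)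
  also have "(\<Sum>e\<in>E. failure_prob \<Omega> Q t (insert e E)) = real (card E) * F"
    by (simp add: F_def insert_absorb)
  finally have sum_eq: "(\<Sum>e\<in>\<Omega>. failure_prob \<Omega> Q t (insert e E)) = S + real (card E) * F" .
  \<comment> \<open>A repeated element leaves \<open>E\<close> unchanged with \<open>t\<close> draws
    to go, which contributes \<open>F\<close>. Since the average over new elements is at most
    \<open>F\<close>, mixing in the repetitions can only raise it.\<close>
  have "S / real (card (\<Omega> - E)) \<le> F"
    using failure_prob_Suc_le[where Q = Q and t = t, OF fin E up] by (simp add: S_def F_def)
  then have "S \<le> F * real (card (\<Omega> - E))"
    using pos by (simp add: divide_simps)
  then have "real (card E) * S \<le> real (card E) * (F * real (card (\<Omega> - E)))"
    by (rule mult_left_mono) simp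
  then have "S * real (card \<Omega>) \<le> (S + real (card E) * F) * real (card (\<Omega> - E))"
    unfolding tot by (simp add: algebra_simps)
  then have "S / real (card (\<Omega> - E)) \<le> (S + real (card E) * F) / real (card \<Omega>)"
    using pos tot by (simp add: divide_simps mult.commute)
  then show ?thesis by (simp add: S_def sum_eq)
qed

text \<open>\<open>Q\<close> need only be sufficient for membership in \<open>S\<close>. This lets a
  monotone event with a simple drawing process, such as a matching inside a fixed set or an edge
  across a fixed cut, stand in for the perfect matching.\<close>

lemma prob_uniform_random_graph_ge:
  fixes V :: "'a set"
  assumes fin: "finite V" and m: "m \<le> card V choose 2"
    and Q: "\<And>G. G \<subseteq> nsets V 2 \<Longrightarrow> Q G \<Longrightarrow> G \<in> S"
  shows "measure_pmf.prob (uniform_random_graph V m) S \<ge> 1 - failure_prob (nsets V 2) Q m {}"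
proof -
  define \<Omega> where "\<Omega> = nsets V 2"
  define X where "X = {E. E \<subseteq> \<Omega> \<and> card E = m}"
  have fin\<Omega>: "finite \<Omega>" using fin by (simp add: \<Omega>_def finite_imp_finite_nsets)
  have card\<Omega>: "card \<Omega> = card V choose 2" by (simp add: \<Omega>_def)
  have finX: "finite X"
    unfolding X_def by (rule finite_subset[of _ "Pow \<Omega>"]) (use fin\<Omega> in auto)
  have cardX: "card X = card \<Omega> choose m"
    unfolding X_def using fin\<Omega> n_subsets by blast
  have posX: "card X > 0" using cardX m card\<Omega> by (simp add: zero_less_binomial_iff)
  then have neX: "X \<noteq> {}" by auto
  have F: "failure_prob \<Omega> Q m {} = real (card {E \<in> X. \<not> Q E}) / real (card X)"
  proof -
    have "{E. E \<subseteq> \<Omega> - {} \<and> card E = m \<and> \<not> Q ({} \<union> E)} = {E \<in> X. \<not> Q E}"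
      by (auto simp: X_def)
    then show ?thesis
      using failure_prob_eq_card[OF fin\<Omega>, of "{}" m Q] m card\<Omega> cardX posX
      by (simp add: field_simps)
  qed
  have "X = {E \<in> X. Q E} \<union> {E \<in> X. \<not> Q E}" by auto
  then have split: "card X = card {E \<in> X. Q E} + card {E \<in> X. \<not> Q E}"
    using card_Un_disjoint[of "{E \<in> X. Q E}" "{E \<in> X. \<not> Q E}"] finX by auto
  have "card {E \<in> X. Q E} \<le> card (X \<inter> S)"
    by (rule card_mono) (use finX Q in \<open>auto simp: X_def \<Omega>_def\<close>)
  moreover have "1 - failure_prob \<Omega> Q m {} = real (card {E \<in> X. Q E}) / real (card X)"
    using posX unfolding F by (simp add: divide_simps) (simp add: split)
  ultimately have "1 - failure_prob \<Omega> Q m {} \<le> real (card (X \<inter> S)) / real (card X)"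
    using posX by (simp add: divide_right_mono)
  also have "\<dots> = measure_pmf.prob (pmf_of_set X) S"
    by (simp add: measure_pmf_of_set[OF neX finX])
  also have "pmf_of_set X = uniform_random_graph V m"
    by (simp add: uniform_random_graph_def X_def \<Omega>_def)
  finally show ?thesis by (simp add: \<Omega>_def)
qed

section \<open>Matchings\<close>

definition matching :: "'a set set \<Rightarrow> 'a set set \<Rightarrow> bool" where
  "matching E M \<longleftrightarrow> M \<subseteq> E \<and> pairwise disjnt M"

lemma matching_mono: "matching E M \<Longrightarrow> E \<subseteq> E' \<Longrightarrow> matching E' M"
  by (auto simp: matching_def)

lemma matching_subset: "matching E M \<Longrightarrow> M' \<subseteq> M \<Longrightarrow> matching E M'"
  by (auto simp: matching_def intro: pairwise_subset)

lemma matching_insert: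
  "matching E M \<Longrightarrow> e \<in> E \<Longrightarrow> e \<inter> \<Union>M = {} \<Longrightarrow> matching E (insert e M)"
  by (auto simp: matching_def pairwise_insert disjnt_def)

lemma matching_Un:
  assumes "matching E M" "matching E N" "\<Union>M \<inter> \<Union>N = {}"
  shows "matching E (M \<union> N)"
proof -
  have "disjnt e f" "disjnt f e" if "e \<in> M" "f \<in> N" for e f
    using that assms(3) unfolding disjnt_def by blast+
  then show ?thesis using assms(1,2) by (auto simp: matching_def pairwise_def)
qed

lemma finite_matching:
  assumes "finite W" "E \<subseteq> nsets W 2" "matching E M"
  shows "finite M"
  using assms finite_imp_finite_nsets[of W 2] by (auto simp: matching_def intro: finite_subset)

lemma card_Union_matching:
  assumes "E \<subseteq> nsets W 2" "matching E M"
  shows "card (\<Union>M) = 2 * card M"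
proof -
  have "card (\<Union>M) = sum card M"
    using assms by (intro card_Union_disjoint) (auto simp: matching_def nsets_def)
  also have "\<dots> = (\<Sum>e\<in>M. 2)"
    using assms by (intro sum.cong) (auto simp: matching_def nsets_def)
  finally show ?thesis by simp
qed

lemma Union_matching_subset:
  assumes "E \<subseteq> nsets W 2" "matching E M"
  shows "\<Union>M \<subseteq> W"
  using assms by (auto simp: matching_def nsets_def)

lemma matching_same_edge:
  assumes "matching E M" "e \<in> M" "f \<in> M" "v \<in> e" "v \<in> f"
  shows "e = f"
  using assms unfolding matching_def pairwise_def disjnt_def by blast

lemma real_choose_2: "real (n choose 2) = real n * (real n - 1) / 2"
  by (induction n) (auto simp: numeral_2_eq_2 field_simps)

definition cross_pairs :: "'a set \<Rightarrow> 'a set \<Rightarrow> 'a set set" where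
  "cross_pairs A B = (\<lambda>(x, y). {x, y}) ` (A \<times> B)"

lemma card_cross_pairs:
  assumes "A \<inter> B = {}"
  shows "card (cross_pairs A B) = card A * card B"
proof -
  have "inj_on (\<lambda>(x, y). {x, y}) (A \<times> B)"
    using assms by (auto simp: inj_on_def doubleton_eq_iff)
  then show ?thesis
    by (simp add: cross_pairs_def card_image card_cartesian_product)
qed

lemma cross_pairs_subset_nsets:
  "A \<inter> B = {} \<Longrightarrow> A \<subseteq> W \<Longrightarrow> B \<subseteq> W \<Longrightarrow> cross_pairs A B \<subseteq> nsets W 2"
  by (auto simp: cross_pairs_def)

lemma cross_pairs_disjoint:
  assumes "A \<inter> B = {}" "A \<inter> C = {}" "B \<inter> C = {}"
  shows "cross_pairs A B \<inter> cross_pairs A C = {}"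
  using assms by (auto simp: cross_pairs_def doubleton_eq_iff)

lemma nsets_cross_pairs_disjoint: "A \<inter> B = {} \<Longrightarrow> nsets A 2 \<inter> cross_pairs A B = {}"
  by (auto simp: cross_pairs_def nsets_def)

section \<open>Matchings inside a vertex set\<close>

text \<open>
  A cherry is a path with two edges: a matching edge \<open>\<phi> x\<close> together with an unmatched vertex \<open>x\<close>
  attached to one of its ends. Either end of the path may be left unmatched, so a further edge
  from a free vertex to any of the two ends enlarges the matching.
\<close>

definition cherry_state :: "'a set \<Rightarrow> 'a set set \<Rightarrow> nat \<Rightarrow> nat \<Rightarrow> bool" where
  "cherry_state U E k c \<longleftrightarrow> (\<exists>M X \<phi>. matching (E \<inter> nsets U 2) M \<and> card M = k \<and>
     X \<subseteq> U - \<Union>M \<and> card X = c \<and> inj_on \<phi> X \<and> \<phi> ` X \<subseteq> M \<and> (\<forall>x\<in>X. \<exists>u\<in>\<phi> x. {x, u} \<in> E))"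

text \<open>The witnesses are merely claimed to exist, so one edge set can be in several states, and
  an edge that brings no progress keeps the current one.\<close>

lemma cherry_state_mono: "cherry_state U E k c \<Longrightarrow> E \<subseteq> E' \<Longrightarrow> cherry_state U E' k c"
proof -
  assume "cherry_state U E k c" and EE: "E \<subseteq> E'"
  then obtain M X \<phi> where *: "matching (E \<inter> nsets U 2) M" "card M = k" "X \<subseteq> U - \<Union>M" "card X = c"
    "inj_on \<phi> X" "\<phi> ` X \<subseteq> M" and adj: "\<forall>x\<in>X. \<exists>u\<in>\<phi> x. {x, u} \<in> E"
    unfolding cherry_state_def by blast
  have "matching (E' \<inter> nsets U 2) M" using *(1) by (rule matching_mono) (use EE in auto)
  moreover have "\<forall>x\<in>X. \<exists>u\<in>\<phi> x. {x, u} \<in> E'" using adj EE by blast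
  ultimately show ?thesis unfolding cherry_state_def using * by blast
qed

lemma cherry_state_empty: "cherry_state U {} 0 0"
proof -
  have "matching ({} \<inter> nsets U 2) {}" by (simp add: matching_def)
  then show ?thesis unfolding cherry_state_def by fastforce
qed

text \<open>Let \<open>F\<close> be the unmatched vertices of \<open>U\<close> outside all cherries.
  A pair inside \<open>F\<close> extends the matching, a pair from \<open>F\<close> to either end of
  a cherry extends it and uses that cherry up, and a pair from \<open>F\<close> to a matching edge
  without cherry creates one. The three kinds are disjoint and counted exactly, as their
  probabilities enter the drift.\<close>

lemma cherry_state_step:
  assumes finU: "finite U" and st: "cherry_state U E k c"
  obtains S1 S2 S3 where
    "c \<le> k" "2 * k + c \<le> card U"
    "S1 \<subseteq> nsets U 2" "S2 \<subseteq> nsets U 2" "S3 \<subseteq> nsets U 2"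
    "S1 \<inter> S2 = {}" "S1 \<inter> S3 = {}" "S2 \<inter> S3 = {}"
    "card S1 = (card U - 2 * k - c) choose 2"
    "card S2 = (card U - 2 * k - c) * (2 * c)"
    "card S3 = (card U - 2 * k - c) * (2 * (k - c))"
    "\<And>e. e \<in> S1 \<Longrightarrow> cherry_state U (insert e E) (k + 1) c"
    "\<And>e. e \<in> S2 \<Longrightarrow> cherry_state U (insert e E) (k + 1) (c - 1)"
    "\<And>e. e \<in> S3 \<Longrightarrow> cherry_state U (insert e E) k (c + 1)"
proof -
  obtain M X \<phi> where M: "matching (E \<inter> nsets U 2) M" "card M = k"
    and X: "X \<subseteq> U - \<Union>M" "card X = c"
    and \<phi>: "inj_on \<phi> X" "\<phi> ` X \<subseteq> M" "\<forall>x\<in>X. \<exists>u\<in>\<phi> x. {x, u} \<in> E"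
    using st unfolding cherry_state_def by blast
  have finM: "finite M" using finite_matching[OF finU _ M(1)] by simp
  have finX: "finite X" using X finU finite_subset by blast
  have MU: "\<Union>M \<subseteq> U" using Union_matching_subset[OF Int_lower2 M(1)] .
  have cardUM: "card (\<Union>M) = 2 * k" using card_Union_matching[OF Int_lower2 M(1)] M(2) by simp
  have ME: "e \<in> E" "e \<in> nsets U 2" if "e \<in> M" for e using M that by (auto simp: matching_def)
  have same: "e = f" if "e \<in> M" "f \<in> M" "v \<in> e" "v \<in> f" for e f v
    using matching_same_edge[OF M(1)] that by blast
  have "\<exists>u v. \<phi> x = {u, v} \<and> u \<noteq> v \<and> {x, u} \<in> E" if x: "x \<in> X" for x
  proof -
    obtain u where u: "u \<in> \<phi> x" "{x, u} \<in> E" using \<phi> x by blast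
    have "\<phi> x \<in> nsets U 2" using ME \<phi>(2) x by blast
    then obtain p q where "\<phi> x = {p, q}" "p \<noteq> q" by (auto simp: nsets_2_eq)
    then show ?thesis using u by (cases "u = p") (auto simp: insert_commute)
  qed
  \<comment> \<open>The cherry is the path \<open>x\<close>, \<open>cu x\<close>,
    \<open>cv x\<close>: the vertex \<open>cu x\<close> is its middle and \<open>cv x\<close> the
    end covered by the matching.\<close>
  then obtain cu cv where cuv: "\<And>x. x \<in> X \<Longrightarrow> \<phi> x = {cu x, cv x} \<and> cu x \<noteq> cv x \<and> {x, cu x} \<in> E"
    by metis
  define F where "F = U - \<Union>M - X"
  define Y where "Y = X \<union> cv ` X"
  define W where "W = \<Union>(M - \<phi> ` X)"
  have \<phi>M: "\<phi> x \<in> M" if "x \<in> X" for x using \<phi>(2) that by blast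
  have inj_cv: "inj_on cv X"
  proof (rule inj_onI)
    fix x y assume xy: "x \<in> X" "y \<in> X" "cv x = cv y"
    have "cv x \<in> \<phi> x" "cv x \<in> \<phi> y" using cuv[OF xy(1)] cuv[OF xy(2)] xy(3) by simp_all
    then have "\<phi> x = \<phi> y" using same[OF \<phi>M \<phi>M] xy by blast
    then show "x = y" using \<phi>(1) xy by (auto dest: inj_onD)
  qed
  have cvM: "cv x \<in> \<Union>M" "cu x \<in> \<Union>M" if "x \<in> X" for x using cuv[OF that] \<phi>M[OF that] by auto
  have cardX\<phi>: "card (\<phi> ` X) = c" using \<phi>(1) X by (simp add: card_image)
  have ck: "c \<le> k" using card_mono[OF finM \<phi>(2)] cardX\<phi> M(2) by simp
  have "card (\<Union>M \<union> X) = 2 * k + c"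
    using cardUM X finX finite_subset[OF MU finU] by (subst card_Un_disjoint) auto
  moreover have "F = U - (\<Union>M \<union> X)" "\<Union>M \<union> X \<subseteq> U" using MU X by (auto simp: F_def)
  ultimately have cardF: "card F = card U - 2 * k - c" and le: "2 * k + c \<le> card U"
    using card_Diff_subset[of "\<Union>M \<union> X" U] card_mono[OF finU, of "\<Union>M \<union> X"] finU
      finite_subset[of "\<Union>M \<union> X" U] by auto
  have cardY: "card Y = 2 * c"
  proof -
    have "X \<inter> cv ` X = {}" using X cvM by auto
    then show ?thesis using finX X(2) inj_cv by (simp add: Y_def card_Un_disjoint card_image)
  qed
  have matW: "matching (E \<inter> nsets U 2) (M - \<phi> ` X)"
    by (rule matching_subset[OF M(1)]) auto
  have cardW: "card W = 2 * (k - c)"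
    using card_Union_matching[OF Int_lower2 matW] cardX\<phi> M(2) finM \<phi>(2)
    by (simp add: W_def card_Diff_subset finX)
  have FY: "F \<inter> Y = {}" and FW: "F \<inter> W = {}"
    using cvM by (auto simp: F_def Y_def W_def)
  have YW: "Y \<inter> W = {}"
  proof -
    have False if "x \<in> X" "e \<in> M - \<phi> ` X" "cv x \<in> e" for x e
      using same[of "\<phi> x" e "cv x"] cuv[of x] \<phi>M[of x] that by auto
    moreover have False if "x \<in> X" "e \<in> M - \<phi> ` X" "x \<in> e" for x e
      using X that by auto
    ultimately show ?thesis by (auto simp: Y_def W_def)
  qed
  have sub: "F \<subseteq> U" "Y \<subseteq> U" "W \<subseteq> U"
    using X MU cvM by (auto simp: F_def Y_def W_def)
  show thesis
  proof (rule that[of "nsets F 2" "cross_pairs F Y" "cross_pairs F W"])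
    show "c \<le> k" "2 * k + c \<le> card U" by fact+
    show "nsets F 2 \<subseteq> nsets U 2" using sub(1) by (rule nsets_mono)
    show "cross_pairs F Y \<subseteq> nsets U 2" using cross_pairs_subset_nsets[OF FY] sub by blast
    show "cross_pairs F W \<subseteq> nsets U 2" using cross_pairs_subset_nsets[OF FW] sub by blast
    show "nsets F 2 \<inter> cross_pairs F Y = {}" using nsets_cross_pairs_disjoint[OF FY] .
    show "nsets F 2 \<inter> cross_pairs F W = {}" using nsets_cross_pairs_disjoint[OF FW] .
    show "cross_pairs F Y \<inter> cross_pairs F W = {}" using cross_pairs_disjoint[OF FY FW YW] .
    show "card (nsets F 2) = (card U - 2 * k - c) choose 2" by (simp add: cardF)
    show "card (cross_pairs F Y) = (card U - 2 * k - c) * (2 * c)"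
      by (simp add: card_cross_pairs[OF FY] cardF cardY)
    show "card (cross_pairs F W) = (card U - 2 * k - c) * (2 * (k - c))"
      by (simp add: card_cross_pairs[OF FW] cardF cardW)
  next
    fix e assume e: "e \<in> nsets F 2"
    let ?E = "insert e E \<inter> nsets U 2"
    have eU: "e \<in> nsets U 2" using e nsets_mono[OF sub(1)] by blast
    have eF: "e \<subseteq> F" "e \<noteq> {}" using e by (auto simp: nsets_def)
    have "e \<notin> M" using eF by (auto simp: F_def)
    moreover have "matching ?E (insert e M)"
      by (rule matching_insert) (use M eU eF in \<open>auto simp: F_def intro: matching_mono\<close>)
    moreover have "X \<subseteq> U - \<Union>(insert e M)" using X eF by (auto simp: F_def)
    moreover have "card (insert e M) = k + 1" using finM M(2) \<open>e \<notin> M\<close> by simp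
    moreover have "\<phi> ` X \<subseteq> insert e M" "\<forall>x\<in>X. \<exists>u\<in>\<phi> x. {x, u} \<in> insert e E"
      using \<phi> by blast+
    ultimately show "cherry_state U (insert e E) (k + 1) c"
      unfolding cherry_state_def using X(2) \<phi>(1) by blast
  next
    fix e assume "e \<in> cross_pairs F Y"
    then obtain w y where e: "e = {w, y}" "w \<in> F" "y \<in> Y" by (auto simp: cross_pairs_def)
    let ?E = "insert e E \<inter> nsets U 2"
    have eU: "e \<in> nsets U 2" using e sub FY by auto
    have M': "matching ?E M" using M(1) by (rule matching_mono) auto
    from e(3) consider "y \<in> X" | x where "x \<in> X" "y = cv x" by (auto simp: Y_def)
    then show "cherry_state U (insert e E) (k + 1) (c - 1)"
    proof cases
      case 1
      have "matching ?E (insert e M)"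
        by (rule matching_insert[OF M']) (use eU e 1 X in \<open>auto simp: F_def\<close>)
      moreover have "e \<notin> M" using e by (auto simp: F_def)
      moreover have "X - {y} \<subseteq> U - \<Union>(insert e M)" using X e by (auto simp: F_def)
      moreover have "card (insert e M) = k + 1" using finM M(2) \<open>e \<notin> M\<close> by simp
      moreover have "\<phi> ` (X - {y}) \<subseteq> insert e M"
        "\<forall>x\<in>X - {y}. \<exists>u\<in>\<phi> x. {x, u} \<in> insert e E"
        using \<phi> by blast+
      moreover have "card (X - {y}) = c - 1" using X 1 finX by simp
      moreover have "inj_on \<phi> (X - {y})" using \<phi>(1) by (rule inj_on_diff)
      ultimately show ?thesis unfolding cherry_state_def by blast
    next
      \<comment> \<open>Switching from \<open>{cu x, cv x}\<close> to \<open>{x, cu x}\<close>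
        exposes \<open>cv x\<close>, which is then matched to \<open>w\<close>.\<close>
      case 2
      note x = \<open>x \<in> X\<close>
      define N where "N = M - {\<phi> x}"
      have N: "matching ?E N" by (rule matching_subset[OF M']) (auto simp: N_def)
      have UN: "\<Union>N \<inter> \<phi> x = {}" using same \<phi>M[OF x] by (auto simp: N_def)
      have UNM: "\<Union>N \<subseteq> \<Union>M" by (auto simp: N_def)
      have xu: "cu x \<noteq> cv x" "\<phi> x = {cu x, cv x}" "{x, cu x} \<in> E" using cuv[OF x] by auto
      have xM: "x \<notin> \<Union>M" "x \<in> U" using X x by auto
      have wM: "w \<notin> \<Union>M" "w \<noteq> x" "w \<in> U" using e x by (auto simp: F_def)
      have cuvM: "cu x \<in> \<Union>M" "cv x \<in> \<Union>M" using cvM[OF x] by auto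
      have m1: "matching ?E (insert {x, cu x} N)"
      proof (rule matching_insert[OF N])
        show "{x, cu x} \<in> ?E" using xu xM cuvM MU by auto
        show "{x, cu x} \<inter> \<Union>N = {}" using xu UN xM UNM by auto
      qed
      have m2: "matching ?E (insert e (insert {x, cu x} N))"
      proof (rule matching_insert[OF m1])
        show "e \<in> ?E" using eU by auto
        show "e \<inter> \<Union>(insert {x, cu x} N) = {}"
          using e 2 xu UN wM UNM cuvM xM by auto
      qed
      have "card N = k - 1" using \<phi>M[OF x] finM M(2) by (simp add: N_def)
      moreover have "{x, cu x} \<notin> N" using xM UNM by auto
      moreover have "e \<notin> insert {x, cu x} N"
        using e wM UNM cuvM by (auto simp: doubleton_eq_iff)
      moreover have "finite N" using finM by (simp add: N_def)
      moreover have "k \<ge> 1"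
        using ck x X(2) finX by (metis One_nat_def Suc_leI card_gt_0_iff empty_iff le_trans)
      ultimately have cM: "card (insert e (insert {x, cu x} N)) = k + 1" by simp
      have "\<phi> ` (X - {x}) \<subseteq> insert e (insert {x, cu x} N)"
        using \<phi> x by (auto simp: N_def inj_on_def)
      moreover have "X - {x} \<subseteq> U - \<Union>(insert e (insert {x, cu x} N))"
        using X e 2 cuvM by (auto simp: F_def N_def)
      moreover have "card (X - {x}) = c - 1" using X x finX by simp
      moreover have "inj_on \<phi> (X - {x})" using \<phi>(1) by (rule inj_on_diff)
      moreover have "\<forall>x'\<in>X - {x}. \<exists>u\<in>\<phi> x'. {x', u} \<in> insert e E" using \<phi>(3) by blast
      ultimately show ?thesis unfolding cherry_state_def using m2 cM by blast
    qed
  next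
    fix e assume "e \<in> cross_pairs F W"
    then obtain w y where e: "e = {w, y}" "w \<in> F" "y \<in> W" by (auto simp: cross_pairs_def)
    then obtain g where g: "g \<in> M" "g \<notin> \<phi> ` X" "y \<in> g" by (auto simp: W_def)
    have w: "w \<in> U" "w \<notin> \<Union>M" "w \<notin> X" using e by (auto simp: F_def)
    have M': "matching (insert e E \<inter> nsets U 2) M" using M(1) by (rule matching_mono) auto
    have "inj_on (\<phi>(w := g)) (insert w X)"
      using \<phi>(1) g w by (auto simp: inj_on_def)
    moreover have "(\<phi>(w := g)) ` insert w X \<subseteq> M" using \<phi>(2) g by auto
    moreover have "\<forall>x\<in>insert w X. \<exists>u\<in>(\<phi>(w := g)) x. {x, u} \<in> insert e E"
      using \<phi>(3) g e w by auto
    moreover have "card (insert w X) = c + 1" using X finX w by simp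
    moreover have "insert w X \<subseteq> U - \<Union>M" using X w by auto
    ultimately show "cherry_state U (insert e E) k (c + 1)"
      unfolding cherry_state_def using M' M(2) by blast
  qed
qed

section \<open>The potential function of the cherry process\<close>

text \<open>With \<open>u = e - 2 * x\<close>, a greedy process would need a function with
  derivative \<open>1 / (4 * (1/2 + u)^2) = 1 - 4 * u + 12 * u^2 - ...\<close>, which integrates to
  more than \<open>e\<close>. The cubic term used here vanishes at 0 and at \<open>e\<close> and has
  derivative \<open>13 * u^2 - 26 * x * (e - x)\<close>. Its first part covers
  \<open>12 * u^2\<close>; its second part keeps the integral at \<open>e\<close>, and this deficit
  is what the cherries pay for.\<close>

definition gain :: "real \<Rightarrow> real \<Rightarrow> real" where
  "gain e x = x - 4 * x * (e - x) + 13 * x * (e - x) * (e - 2 * x)"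

definition gain' :: "real \<Rightarrow> real \<Rightarrow> real" where
  "gain' e x = 1 - 4 * (e - 2 * x) + 13 * (e - 2 * x)\<^sup>2 - 26 * x * (e - x)"

text \<open>The derivative of \<open>gain e\<close> is \<open>gain' e\<close>, and
  \<open>gain e\<close> is convex in this range, with second derivative
  \<open>8 - 78 * (e - 2 * x)\<close>; so a forward difference is at least the derivative. The
  equation \<open>id\<close> is the exact Taylor expansion of a cubic.\<close>

lemma gain_increment:
  assumes "0 < n" "0 \<le> e" "e \<le> 1/1000" "0 \<le> x"
  shows "n * gain e (x + 1 / n) - n * gain e x \<ge> gain' e x"
proof -
  define h where "h = 1 / n"
  have h: "h > 0" "n * h = 1" using assms by (auto simp: h_def)
  have id: "gain e (x + h) - gain e x = h * gain' e x + h\<^sup>2 / 2 * (8 - 78 * (e - 2 * x)) + 26 * h ^ 3"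
    unfolding gain_def gain'_def by (simp add: field_simps power2_eq_square power3_eq_cube)
  have "8 - 78 * (e - 2 * x) \<ge> 0" using assms by simp
  then have "gain e (x + h) - gain e x \<ge> h * gain' e x"
    unfolding id using h by simp
  then have "n * (gain e (x + h) - gain e x) \<ge> n * (h * gain' e x)"
    using assms by (intro mult_left_mono) auto
  moreover have "n * (h * gain' e x) = gain' e x"
    using h by (metis mult.assoc mult_1)
  ultimately show ?thesis by (simp add: h_def right_diff_distrib)
qed

lemma gain'_bounds:
  assumes "0 \<le> e" "e \<le> 1/1000" "0 \<le> x" "x \<le> e"
  shows "99/100 \<le> gain' e x" "gain' e x \<le> 101/100"
proof -
  define y where "y = x * (e - x)"
  define q where "q = (e - 2 * x)\<^sup>2"
  have "y \<le> 1/1000 * (1/1000)"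
    unfolding y_def by (rule mult_mono) (use assms in auto)
  moreover have "0 \<le> y" using assms by (simp add: y_def)
  moreover have "\<bar>e - 2 * x\<bar> \<le> 1/1000" by (rule abs_leI) (use assms in linarith)+
  then have "q \<le> (1/1000)\<^sup>2"
    unfolding q_def by (metis abs_ge_zero power2_abs power_mono)
  then have "q \<le> 1/1000000" by (simp add: power2_eq_square)
  moreover have "0 \<le> q" by (simp add: q_def)
  moreover have "gain' e x = 1 - 4 * (e - 2 * x) + 13 * q - 26 * y"
    by (simp add: gain'_def q_def y_def)
  ultimately show "99/100 \<le> gain' e x" "gain' e x \<le> 101/100"
    using assms by auto
qed

text \<open>
  The second-order terms of the drift cancel. The constants 13, 26 and 7/2 are chosen such that
  the remaining third-order terms are nonnegative, while \<open>gain e e = e\<close>.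
\<close>

lemma drift_ge_quarter:
  fixes e x z :: real
  assumes "0 \<le> z" "z \<le> x" "x \<le> e" "e \<le> 1/1000"
  defines "f \<equiv> 1/2 + e - 2 * x - z"
  defines "\<delta>1 \<equiv> gain' e x - 7/2 * z" and "\<delta>3 \<equiv> 7/2 * (e - x)"
  shows "f\<^sup>2 * \<delta>1 + 4 * f * z * (\<delta>1 - \<delta>3) + 4 * f * (x - z) * \<delta>3 \<ge> 1/4"
proof -
  define u where "u = e - 2 * x"
  define r where "r = 1/2 + u"
  define y where "y = x * (e - x)"
  define g where "g = gain' e x"
  have x: "0 \<le> x" using assms by linarith
  have u: "\<bar>u\<bar> \<le> 1/1000" unfolding u_def by (rule abs_leI) (use assms(1-4) x in linarith)+
  have y: "0 \<le> y" using assms x by (auto simp: y_def)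
  have g: "99/100 \<le> g" "g \<le> 101/100" using gain'_bounds[of e x] assms x by (auto simp: g_def)
  have g_eq: "g = 1 - 4 * u + 13 * u\<^sup>2 - 26 * y" by (simp add: g_def gain'_def u_def y_def)
  \<comment> \<open>Expansion in the number of cherries: the part free of \<open>z\<close> comes
    from new matching edges and newly created cherries. To leading order \<open>bracket\<close> is
    \<open>1 - w/4\<close> for a cherry weight \<open>w\<close>, which requires
    \<open>w < 4\<close>, while the deficit \<open>26 * y\<close> requires
    \<open>w \<ge> 13/4\<close>; the choice is \<open>w = 7/2\<close>.\<close>
  define bracket where
    "bracket = g * (2 * r - 3 * z) - 7/2 * (r\<^sup>2 + z * (2 * r - 3 * z)) - 14 * (e - x) * (2 * r - 2 * z + x)"
  have "f\<^sup>2 * \<delta>1 + 4 * f * z * (\<delta>1 - \<delta>3) + 4 * f * (x - z) * \<delta>3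
      = (g * r\<^sup>2 + 14 * y * r) + z * bracket"
    unfolding f_def \<delta>1_def \<delta>3_def r_def bracket_def g_def[symmetric] u_def y_def
    by (simp add: field_simps power2_eq_square)
  moreover have "g * r\<^sup>2 + 14 * y * r \<ge> 1/4"
  proof -
    \<comment> \<open>The linear terms in \<open>u\<close> cancel. What is left to leading order is
      \<open>13/4 - 3 = 1/4\<close> times \<open>u^2\<close> and \<open>7 - 13/2 = 1/2\<close> times
      \<open>y\<close>.\<close>
    have "g * r\<^sup>2 + 14 * y * r
        = 1/4 + u\<^sup>2 * (1 + 36 * u + 52 * u\<^sup>2) / 4 + y * (1/2 - 12 * u - 26 * u\<^sup>2)"
      unfolding g_eq r_def by (simp add: field_simps power2_eq_square)
    moreover have u2: "u\<^sup>2 \<le> 1/1000"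
    proof -
      have "u\<^sup>2 \<le> (1/1000)\<^sup>2" using u by (metis abs_ge_zero power2_abs power_mono)
      then show ?thesis by (simp add: power2_eq_square)
    qed
    have "- (1/1000) \<le> u" "u \<le> 1/1000" using u by (auto simp: abs_le_iff)
    then have "0 \<le> 1 + 36 * u + 52 * u\<^sup>2" "0 \<le> 1/2 - 12 * u - 26 * u\<^sup>2"
      using u2 zero_le_power2[of u] by linarith+
    ultimately show ?thesis using y by simp
  qed
  moreover have "bracket \<ge> 0"
  proof -
    have r: "499/1000 \<le> r" "r \<le> 501/1000" using u by (auto simp: r_def abs_le_iff)
    have z: "z \<le> 1/1000" using assms by linarith
    note b = assms(1-4) g r z x
    define s where "s = g * (2 * r - 3 * z)"
    define t where "t = r\<^sup>2"
    define v where "v = z * (2 * r - 3 * z)"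
    define w where "w = (e - x) * (2 * r - 2 * z + x)"
    have "99/100 * (995/1000) \<le> s"
      unfolding s_def by (rule mult_mono) (use b in linarith)+
    moreover have "t \<le> (501/1000)\<^sup>2" unfolding t_def by (rule power_mono) (use b in linarith)+
    moreover have "v \<le> 1/1000 * (1002/1000)"
      unfolding v_def by (rule mult_mono) (use b in linarith)+
    moreover have "w \<le> 1/1000 * (1003/1000)"
      unfolding w_def by (rule mult_mono) (use b in linarith)+
    ultimately have "2 * s - 7 * t - 7 * v - 28 * w \<ge> 0" by (simp add: power2_eq_square)
    moreover have "2 * bracket = 2 * s - 7 * t - 7 * v - 28 * w"
      unfolding bracket_def s_def t_def v_def w_def by (simp add: algebra_simps)
    ultimately show ?thesis by linarith
  qed
  then have "0 \<le> z * bracket" using assms(1) by simp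
  ultimately show ?thesis by linarith
qed

text \<open>A cherry is worth \<open>7/2 * (a - k) / n\<close>: it is useful while edges are missing
  and worthless at the end, so the potential at \<open>k = a\<close> equals \<open>a\<close> for
  every number of cherries.\<close>

definition potential :: "real \<Rightarrow> real \<Rightarrow> real \<Rightarrow> real \<Rightarrow> real" where
  "potential n a k c = n * gain (a / n) (k / n) + 7/2 * (a - k) * c / n"

lemma potential_0 [simp]: "potential n a 0 0 = 0"
  by (simp add: potential_def gain_def)

text \<open>The difference to \<open>a\<close> has the factor \<open>e - x\<close>, and the other
  factor is close to 1. This makes the exponential bound at least 1 when no draws are left, which
  starts the induction on their number.\<close>

lemma potential_le:
  assumes "0 < n" "0 \<le> c" "c \<le> k" "k \<le> a" "a \<le> n / 1000"
  shows "potential n a k c \<le> a"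
proof -
  define e x z where "e = a / n" and "x = k / n" and "z = c / n"
  have b: "0 \<le> z" "z \<le> x" "x \<le> e" "e \<le> 1/1000"
    using assms by (auto simp: e_def x_def z_def divide_right_mono divide_simps)
  have "a - potential n a k c = n * ((e - x) * (1 + 4 * x - 13 * (x * (e - 2 * x)) - 7/2 * z))"
    using assms(1) unfolding potential_def gain_def e_def x_def z_def by (simp add: field_simps)
  moreover define y where "y = x * (e - 2 * x)"
  have "y \<le> 1/1000 * (1/1000)"
  proof -
    have "y \<le> x * e" unfolding y_def by (rule mult_left_mono) (use b in linarith)+
    also have "\<dots> \<le> 1/1000 * (1/1000)" by (rule mult_mono) (use b in linarith)+
    finally show ?thesis .
  qed
  then have "1 + 4 * x - 13 * y - 7/2 * z \<ge> 0" using b by simp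
  then have "0 \<le> n * ((e - x) * (1 + 4 * x - 13 * (x * (e - 2 * x)) - 7/2 * z))"
    unfolding y_def using b assms(1) by (intro mult_nonneg_nonneg) auto
  ultimately have "a - potential n a k c \<ge> 0" by simp
  then show ?thesis by simp
qed

lemma potential_increments:
  assumes "0 < n" "0 \<le> c" "c \<le> k" "k \<le> a" "a \<le> n / 1000"
  defines "\<delta>1 \<equiv> gain' (a / n) (k / n) - 7/2 * (c / n)" and "\<delta>3 \<equiv> 7/2 * (a / n - k / n)"
  shows "potential n a (k + 1) c \<ge> potential n a k c + \<delta>1"
    and "potential n a (k + 1) (c - 1) \<ge> potential n a k c + (\<delta>1 - \<delta>3)"
    and "potential n a k (c + 1) = potential n a k c + \<delta>3"
proof -
  have "(k + 1) / n = k / n + 1 / n" by (rule add_divide_distrib)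
  moreover have "0 \<le> a / n" "a / n \<le> 1/1000" "0 \<le> k / n"
    using assms(1-5) by (auto simp: divide_simps)
  ultimately have g: "n * gain (a / n) ((k + 1) / n) - n * gain (a / n) (k / n) \<ge> gain' (a / n) (k / n)"
    using gain_increment[OF assms(1)] by simp
  have 1: "7/2 * (a - (k + 1)) * c / n = 7/2 * (a - k) * c / n - 7/2 * (c / n)"
    using assms(1) by (simp add: field_simps)
  show 2: "potential n a (k + 1) c \<ge> potential n a k c + \<delta>1"
    using g unfolding potential_def \<delta>1_def 1 by simp
  \<comment> \<open>Giving up a cherry after the matching has grown costs slightly less than before;
    the mixed difference \<open>7 / (2 * n)\<close> has the favourable sign.\<close>
  have "7/2 * (a - (k + 1)) * (c - 1) / n = 7/2 * (a - (k + 1)) * c / n - \<delta>3 + 7 / (2 * n)"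
    using assms(1) unfolding \<delta>3_def by (simp add: field_simps)
  moreover have "7 / (2 * n) \<ge> 0" using assms(1) by simp
  ultimately have "potential n a (k + 1) (c - 1) \<ge> potential n a (k + 1) c - \<delta>3"
    unfolding potential_def by simp
  then show "potential n a (k + 1) (c - 1) \<ge> potential n a k c + (\<delta>1 - \<delta>3)"
    using 2 by simp
  have "7/2 * (a - k) * (c + 1) / n = 7/2 * (a - k) * c / n + \<delta>3"
    using assms(1) unfolding \<delta>3_def by (simp add: field_simps)
  then show "potential n a k (c + 1) = potential n a k c + \<delta>3"
    unfolding potential_def by simp
qed

lemma exp_minus_le:
  assumes "0 \<le> (x::real)"
  shows "exp (- x) \<le> 1 - x + x\<^sup>2"
proof -
  have "1 \<le> (1 - x + x\<^sup>2) * (1 + x)"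
    using assms by (simp add: field_simps power2_eq_square)
  also have "\<dots> \<le> (1 - x + x\<^sup>2) * exp x"
  proof (rule mult_left_mono)
    have "1 - x + x\<^sup>2 = (x - 1/2)\<^sup>2 + 3/4" by (simp add: field_simps power2_eq_square)
    then show "0 \<le> 1 - x + x\<^sup>2" by (metis add_nonneg_nonneg zero_le_power2 zero_le_divide_iff zero_le_numeral)
  qed simp
  finally show ?thesis by (simp add: exp_minus field_simps)
qed

text \<open>The three probabilities belong to the three kinds of useful draws, and the remaining
  mass changes nothing. Increments of at most 2 keep the quadratic term of the exponential below
  \<open>4 * \<theta>^2\<close>, which is the loss \<open>4 * \<theta>\<close> in the rate.\<close>

lemma exp_step_bound:
  fixes p1 p2 p3 d1 d2 d3 \<theta> D :: real
  assumes "0 \<le> p1" "0 \<le> p2" "0 \<le> p3" "p1 + p2 + p3 \<le> 1"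
    and "0 \<le> d1" "d1 \<le> 2" "0 \<le> d2" "d2 \<le> 2" "0 \<le> d3" "d3 \<le> 2" "0 \<le> \<theta>"
    and D: "D \<le> p1 * d1 + p2 * d2 + p3 * d3"
  shows "p1 * exp (- (\<theta> * d1)) + p2 * exp (- (\<theta> * d2)) + p3 * exp (- (\<theta> * d3)) + (1 - p1 - p2 - p3)
    \<le> exp (- (\<theta> * (D - 4 * \<theta>)))"
proof -
  have *: "p * exp (- (\<theta> * d)) \<le> p * (1 + 4 * \<theta>\<^sup>2) - \<theta> * (p * d)"
    if "0 \<le> p" "0 \<le> d" "d \<le> 2" for p d
  proof -
    have "(\<theta> * d)\<^sup>2 \<le> (\<theta> * 2)\<^sup>2" using that assms(11) by (intro power_mono mult_left_mono) auto
    then have "exp (- (\<theta> * d)) \<le> 1 - \<theta> * d + 4 * \<theta>\<^sup>2"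
      using exp_minus_le[of "\<theta> * d"] that assms(11) by (simp add: power_mult_distrib)
    then have "p * exp (- (\<theta> * d)) \<le> p * (1 - \<theta> * d + 4 * \<theta>\<^sup>2)"
      using that by (intro mult_left_mono) auto
    then show ?thesis by (simp add: algebra_simps)
  qed
  have "p1 * exp (- (\<theta> * d1)) + p2 * exp (- (\<theta> * d2)) + p3 * exp (- (\<theta> * d3)) + (1 - p1 - p2 - p3)
    \<le> 1 - \<theta> * (p1 * d1 + p2 * d2 + p3 * d3) + (p1 + p2 + p3) * (4 * \<theta>\<^sup>2)"
    using *[of p1 d1] *[of p2 d2] *[of p3 d3] assms by (simp add: algebra_simps)
  also have "\<dots> \<le> 1 - \<theta> * D + 1 * (4 * \<theta>\<^sup>2)"
    using assms by (intro add_mono diff_mono mult_left_mono mult_right_mono) auto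
  also have "\<dots> = 1 + - (\<theta> * (D - 4 * \<theta>))" by (simp add: algebra_simps power2_eq_square)
  also have "\<dots> \<le> exp (- (\<theta> * (D - 4 * \<theta>)))" by (rule exp_ge_add_one_self)
  finally show ?thesis .
qed

lemma sum_le_three_parts:
  fixes r :: "'b \<Rightarrow> real" and b0 b1 b2 b3 :: real
  assumes "finite \<Omega>" "S1 \<subseteq> \<Omega>" "S2 \<subseteq> \<Omega>" "S3 \<subseteq> \<Omega>"
    and "S1 \<inter> S2 = {}" "S1 \<inter> S3 = {}" "S2 \<inter> S3 = {}"
    and "\<And>e. e \<in> S1 \<Longrightarrow> r e \<le> b1" "\<And>e. e \<in> S2 \<Longrightarrow> r e \<le> b2" "\<And>e. e \<in> S3 \<Longrightarrow> r e \<le> b3"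
    and "\<And>e. e \<in> \<Omega> \<Longrightarrow> r e \<le> b0"
  shows "sum r \<Omega> \<le> card S1 * b1 + card S2 * b2 + card S3 * b3
    + (real (card \<Omega>) - card S1 - card S2 - card S3) * b0"
proof -
  define S where "S = S1 \<union> S2 \<union> S3"
  have fin: "finite S1" "finite S2" "finite S3" using assms finite_subset by blast+
  have S: "S \<subseteq> \<Omega>" "finite S" using assms fin by (auto simp: S_def)
  have cS: "card S = card S1 + card S2 + card S3"
    unfolding S_def using fin assms by (subst card_Un_disjoint, auto, subst card_Un_disjoint, auto)
  have "sum r S = sum r S1 + sum r S2 + sum r S3"
    unfolding S_def using fin assms by (subst sum.union_disjoint, auto, subst sum.union_disjoint, auto)
  moreover have "sum r S1 \<le> card S1 * b1" "sum r S2 \<le> card S2 * b2" "sum r S3 \<le> card S3 * b3"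
    using assms by (auto intro!: sum_bounded_above)
  moreover have "sum r (\<Omega> - S) \<le> card (\<Omega> - S) * b0"
    using assms by (auto intro!: sum_bounded_above)
  moreover have "real (card (\<Omega> - S)) = real (card \<Omega>) - card S1 - card S2 - card S3"
    using card_mono[OF assms(1) S(1)] card_Diff_subset[OF S(2,1)] cS by linarith
  moreover have "sum r \<Omega> = sum r (\<Omega> - S) + sum r S" using S assms(1) by (simp add: sum.subset_diff)
  ultimately show ?thesis by simp
qed

definition has_matching :: "'a set \<Rightarrow> nat \<Rightarrow> 'a set set \<Rightarrow> bool" where
  "has_matching U a E \<longleftrightarrow> (\<exists>M. matching (E \<inter> nsets U 2) M \<and> card M = a)"

lemma has_matching_insert:
  assumes "has_matching U a E"
  shows "has_matching U a (insert e E)"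
proof -
  obtain M where M: "matching (E \<inter> nsets U 2) M" "card M = a"
    using assms unfolding has_matching_def by blast
  have "matching (insert e E \<inter> nsets U 2) M"
    by (rule matching_mono[OF M(1)]) auto
  then show ?thesis unfolding has_matching_def using M(2) by blast
qed

text \<open>The \<open>2 * d\<close> vertices missing from \<open>U\<close> and the factor
  \<open>f - 1\<close> in place of \<open>f\<close> lower the free fraction \<open>f0\<close> by at
  most \<open>\<zeta>\<close>. Since \<open>f0 \<ge> 2/5\<close>, this is at worst a factor
  \<open>s = 1 - 5/2 * \<zeta>\<close>, and the scaled drift loses at most
  \<open>s^2 \<ge> 1 - 5 * \<zeta>\<close>.\<close>

lemma cherry_drift:
  fixes n a k c f d \<zeta> :: real
  assumes "0 < n" "0 \<le> c" "c \<le> k" "k \<le> a" "a \<le> n / 1000" "0 \<le> d"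
    and \<zeta>: "\<zeta> = (2 * d + 1) / n" "\<zeta> \<le> 1/20"
    and f: "f \<ge> n / 2 + a - 2 * d - 2 * k - c"
  defines "\<delta>1 \<equiv> gain' (a / n) (k / n) - 7/2 * (c / n)" and "\<delta>3 \<equiv> 7/2 * (a / n - k / n)"
  shows "f * (f - 1) / (n * (n - 1)) * \<delta>1 + 4 * f * c / (n * (n - 1)) * (\<delta>1 - \<delta>3)
      + 4 * f * (k - c) / (n * (n - 1)) * \<delta>3 \<ge> (1 - 5 * \<zeta>) / 4"
    and "0 \<le> \<delta>1" "\<delta>1 \<le> 2" "0 \<le> \<delta>1 - \<delta>3" "\<delta>1 - \<delta>3 \<le> 2" "0 \<le> \<delta>3" "\<delta>3 \<le> 2"
proof -
  define e x z where "e = a / n" and "x = k / n" and "z = c / n"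
  have b: "0 \<le> z" "z \<le> x" "x \<le> e" "e \<le> 1/1000"
    using assms(1-5) by (auto simp: e_def x_def z_def divide_right_mono divide_simps)
  have \<delta>: "\<delta>1 = gain' e x - 7/2 * z" "\<delta>3 = 7/2 * (e - x)"
    by (simp_all add: \<delta>1_def \<delta>3_def e_def x_def z_def)
  have gb: "99/100 \<le> gain' e x" "gain' e x \<le> 101/100"
    using gain'_bounds[of e x] b by auto
  show d1: "0 \<le> \<delta>1" "\<delta>1 \<le> 2" and d2: "0 \<le> \<delta>1 - \<delta>3" "\<delta>1 - \<delta>3 \<le> 2"
    and d3: "0 \<le> \<delta>3" "\<delta>3 \<le> 2"
    unfolding \<delta> right_diff_distrib using b gb by linarith+
  have n: "n \<ge> 20"
  proof -
    have "1 / n \<le> (2 * d + 1) / n" using assms(1,6) by (simp add: divide_right_mono)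
    then have "1 / n \<le> 1 / 20" using \<zeta> by linarith
    then show ?thesis using assms(1) by (simp add: divide_simps)
  qed
  have \<zeta>0: "0 \<le> \<zeta>" using \<zeta> assms(1,6) by simp
  define f0 where "f0 = 1/2 + e - 2 * x - z"
  define s where "s = 1 - 5/2 * \<zeta>"
  define q where "q = (f - 1) / n"
  have f0: "2/5 \<le> f0" using b by (simp add: f0_def)
  have s: "0 \<le> s" "s \<le> 1" using \<zeta>(2) \<zeta>0 by (auto simp: s_def)
  have "q \<ge> f0 - \<zeta>"
  proof -
    have "(n / 2 + a - 2 * d - 2 * k - c - 1) / n \<le> q"
      unfolding q_def using f assms(1) by (intro divide_right_mono) auto
    moreover have "(n / 2 + a - 2 * d - 2 * k - c - 1) / n = f0 - \<zeta>"
      using assms(1) unfolding f0_def e_def x_def z_def \<zeta> by (simp add: field_simps)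
    ultimately show ?thesis by simp
  qed
  moreover have "2/5 * \<zeta> \<le> f0 * \<zeta>" using f0 \<zeta>0 by (rule mult_right_mono)
  then have "\<zeta> \<le> f0 * (5/2 * \<zeta>)" by simp
  moreover have "f0 * s = f0 - f0 * (5/2 * \<zeta>)" by (simp add: s_def algebra_simps)
  ultimately have q: "f0 * s \<le> q" by linarith
  have q0: "0 \<le> q" by (rule order_trans[OF _ q]) (use f0 s in auto)
  have f1: "f \<ge> 1" using q0 assms(1) by (simp add: q_def zero_le_divide_iff)
  have nn: "0 < n * (n - 1)" "n * (n - 1) \<le> n * n" using n by auto
  have P1: "q\<^sup>2 \<le> f * (f - 1) / (n * (n - 1))"
  proof -
    have "q\<^sup>2 = (f - 1) * (f - 1) / (n * n)" by (simp add: q_def power2_eq_square)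
    also have "\<dots> \<le> f * (f - 1) / (n * (n - 1))"
      using f1 nn by (intro frac_le mult_right_mono mult_nonneg_nonneg) auto
    finally show ?thesis .
  qed
  have P2: "4 * q * (w / n) \<le> 4 * f * w / (n * (n - 1))" if "0 \<le> w" for w
  proof -
    have "4 * q * (w / n) = 4 * (f - 1) * w / (n * n)" by (simp add: q_def)
    also have "\<dots> \<le> 4 * f * w / (n * (n - 1))"
      using f1 nn that by (intro frac_le mult_right_mono mult_nonneg_nonneg) auto
    finally show ?thesis .
  qed
  \<comment> \<open>The terms linear in the free fraction lose only \<open>s\<close>; weakening this
    to \<open>s^2\<close> gives a common factor for the whole drift.\<close>
  have ss: "s\<^sup>2 \<le> s" using s by (simp add: power2_eq_square mult_left_le)
  have Q1: "s\<^sup>2 * f0\<^sup>2 \<le> q\<^sup>2"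
    using q f0 s power_mono[of "f0 * s" q 2] by (simp add: power_mult_distrib mult.commute)
  have Q2: "s\<^sup>2 * f0 \<le> q"
  proof -
    have "s\<^sup>2 * f0 \<le> s * f0" by (rule mult_right_mono[OF ss]) (use f0 in simp)
    also have "\<dots> \<le> q" using q by (simp add: mult.commute)
    finally show ?thesis .
  qed
  have xz: "(k - c) / n = x - z" by (simp add: x_def z_def diff_divide_distrib)
  have "1 - 5 * \<zeta> \<le> s\<^sup>2" unfolding s_def by (simp add: power2_eq_square algebra_simps)
  then have "(1 - 5 * \<zeta>) / 4 \<le> s\<^sup>2 * (1/4)" by simp
  also have "\<dots> \<le> s\<^sup>2 * (f0\<^sup>2 * \<delta>1 + 4 * f0 * z * (\<delta>1 - \<delta>3) + 4 * f0 * (x - z) * \<delta>3)"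
    using drift_ge_quarter[OF b] unfolding \<delta> f0_def by (intro mult_left_mono) auto
  also have "\<dots> = (s\<^sup>2 * f0\<^sup>2) * \<delta>1 + 4 * (s\<^sup>2 * f0) * z * (\<delta>1 - \<delta>3) + 4 * (s\<^sup>2 * f0) * (x - z) * \<delta>3"
    by (simp add: algebra_simps)
  also have "\<dots> \<le> q\<^sup>2 * \<delta>1 + 4 * q * z * (\<delta>1 - \<delta>3) + 4 * q * (x - z) * \<delta>3"
    using Q1 Q2 d1 d2 d3 b by (intro add_mono mult_right_mono mult_left_mono) auto
  also have "\<dots> \<le> f * (f - 1) / (n * (n - 1)) * \<delta>1 + 4 * f * c / (n * (n - 1)) * (\<delta>1 - \<delta>3)
      + 4 * f * (k - c) / (n * (n - 1)) * \<delta>3"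
    using P1 P2[of c] P2[of "k - c"] d1 d2 d3 assms(2,3) unfolding xz z_def[symmetric]
    by (intro add_mono mult_right_mono) auto
  finally show "f * (f - 1) / (n * (n - 1)) * \<delta>1 + 4 * f * c / (n * (n - 1)) * (\<delta>1 - \<delta>3)
      + 4 * f * (k - c) / (n * (n - 1)) * \<delta>3 \<ge> (1 - 5 * \<zeta>) / 4" .
qed

text \<open>A supermartingale bound: a draw changes the mean of
  \<open>exp (- \<theta> * potential)\<close> by a factor of at most
  \<open>exp (- \<theta> * \<rho>)\<close>, where \<rho> is the drift minus the second-order loss
  \<open>4 * \<theta>\<close>. Passing to draws with replacement keeps the number of pairs constant.
  The drift is needed only for \<open>k < a\<close>, since at \<open>k = a\<close> the goal is
  reached.\<close>

lemma failure_prob_cherry_le: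
  fixes V U :: "'a set" and a :: nat and d \<theta> :: real
  assumes finV: "finite V" and V0: "card V > 0" and UV: "U \<subseteq> V"
  defines "n \<equiv> real (card V)"
  assumes a: "real a \<le> n / 1000" and d: "0 \<le> d" "(2 * d + 1) / n \<le> 1/20"
    and U: "real (card U) \<ge> n / 2 + real a - 2 * d" and \<theta>: "0 \<le> \<theta>"
  defines "\<rho> \<equiv> (1 - 5 * ((2 * d + 1) / n)) / 4 - 4 * \<theta>"
  assumes "cherry_state U E k c" "k \<le> a" "E \<subseteq> nsets V 2"
  shows "failure_prob (nsets V 2) (has_matching U a) t E
       \<le> exp (\<theta> * (real a - potential n a k c - \<rho> * real t))"
  using assms(11-13)
proof (induction t arbitrary: E k c)
  case 0
  have finU: "finite U" using finV UV finite_subset by blast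
  have "c \<le> k" using cherry_state_step[OF finU 0(1)] by blast
  then have "potential n a k c \<le> a" using potential_le[of n "real c" "real k" "real a"] 0 a V0
    by (simp add: n_def)
  then have "0 \<le> \<theta> * (real a - potential n a k c - \<rho> * real 0)" using \<theta> by simp
  then have "1 \<le> exp (\<theta> * (real a - potential n a k c - \<rho> * real 0))" by (subst one_le_exp_iff)
  then show ?case by simp
next
  case (Suc t)
  define \<Omega> where "\<Omega> = nsets V 2"
  define Q where "Q = has_matching U a"
  have fin\<Omega>: "finite \<Omega>" using finV by (simp add: \<Omega>_def finite_imp_finite_nsets)
  have finU: "finite U" using finV UV finite_subset by blast
  have E\<Omega>: "E \<subseteq> \<Omega>" using Suc.prems by (simp add: \<Omega>_def)
  have up: "Q (insert e E)" if "Q E" for E e using that has_matching_insert by (simp add: Q_def)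
  obtain S1 S2 S3 where S: "c \<le> k" "2 * k + c \<le> card U"
    "S1 \<subseteq> nsets U 2" "S2 \<subseteq> nsets U 2" "S3 \<subseteq> nsets U 2"
    "S1 \<inter> S2 = {}" "S1 \<inter> S3 = {}" "S2 \<inter> S3 = {}"
    "card S1 = (card U - 2 * k - c) choose 2"
    "card S2 = (card U - 2 * k - c) * (2 * c)"
    "card S3 = (card U - 2 * k - c) * (2 * (k - c))"
    and st1: "\<And>e. e \<in> S1 \<Longrightarrow> cherry_state U (insert e E) (k + 1) c"
    and st2: "\<And>e. e \<in> S2 \<Longrightarrow> cherry_state U (insert e E) (k + 1) (c - 1)"
    and st3: "\<And>e. e \<in> S3 \<Longrightarrow> cherry_state U (insert e E) k (c + 1)"
    using cherry_state_step[OF finU Suc.prems(1)] by blast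
  show ?case
  proof (cases "k = a")
    case True
    then have "Q E" using Suc.prems(1) unfolding Q_def has_matching_def cherry_state_def by blast
    then have "failure_prob \<Omega> Q (Suc t) E = 0"
      using failure_prob_success[OF fin\<Omega> E\<Omega>] up by blast
    then show ?thesis by (simp add: \<Omega>_def Q_def del: failure_prob.simps)
  next
    case False
    then have ka: "k + 1 \<le> a" using Suc.prems by simp
    define \<zeta> where "\<zeta> = (2 * d + 1) / n"
    define \<delta>1 where "\<delta>1 = gain' (real a / n) (real k / n) - 7/2 * (real c / n)"
    define \<delta>3 where "\<delta>3 = 7/2 * (real a / n - real k / n)"
    define f where "f = real (card U - 2 * k - c)"
    have n0: "0 < n" using V0 by (simp add: n_def)
    have f_eq: "f = real (card U) - 2 * real k - real c"
      using S(2) by (simp add: f_def of_nat_diff)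
    have f_ge: "f \<ge> n / 2 + real a - 2 * d - 2 * real k - real c" using U f_eq by simp
    have ck: "0 \<le> real c" "real c \<le> real k" "real k \<le> real a" using S(1) ka by auto
    note drift = cherry_drift[OF n0 ck a d(1) \<zeta>_def _ f_ge, folded \<delta>1_def \<delta>3_def, folded \<zeta>_def]
    have \<zeta>20: "\<zeta> \<le> 1/20" using d by (simp add: \<zeta>_def)
    note incr = potential_increments[OF n0 ck a, folded \<delta>1_def \<delta>3_def]
    define B where "B = exp (\<theta> * (real a - potential n a k c - \<rho> * real t))"
    have B: "B * exp (- (\<theta> * \<delta>)) \<ge> exp (\<theta> * (real a - p - \<rho> * real t))"
      if "p \<ge> potential n a k c + \<delta>" for p \<delta>
    proof -
      have "\<theta> * (real a - p - \<rho> * real t) \<le> \<theta> * (real a - (potential n a k c + \<delta>) - \<rho> * real t)"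
        using that \<theta> by (intro mult_left_mono) auto
      also have "\<dots> = \<theta> * (real a - potential n a k c - \<rho> * real t) + - (\<theta> * \<delta>)"
        by (simp add: algebra_simps)
      finally show ?thesis unfolding B_def by (simp add: mult_exp_exp)
    qed
    define r where "r e = failure_prob \<Omega> Q t (insert e E)" for e
    have S\<Omega>: "S1 \<subseteq> \<Omega>" "S2 \<subseteq> \<Omega>" "S3 \<subseteq> \<Omega>"
      using S(3-5) nsets_mono[OF UV, of 2] by (auto simp: \<Omega>_def)
    have ins: "insert e E \<subseteq> nsets V 2" if "e \<in> \<Omega>" for e using E\<Omega> that by (auto simp: \<Omega>_def)
    have r1: "r e \<le> B * exp (- (\<theta> * \<delta>1))" if "e \<in> S1" for e
    proof -
      have "r e \<le> exp (\<theta> * (real a - potential n a (real (k + 1)) c - \<rho> * real t))"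
        unfolding r_def \<Omega>_def Q_def
        by (rule Suc.IH[OF st1[OF that] ka]) (use ins that S\<Omega> in blast)
      also have "\<dots> \<le> B * exp (- (\<theta> * \<delta>1))" by (rule B) (use incr(1) in \<open>simp add: add.commute\<close>)
      finally show ?thesis .
    qed
    have r2: "r e \<le> B * exp (- (\<theta> * (\<delta>1 - \<delta>3)))" if "e \<in> S2" for e
    proof -
      have "card S2 > 0" using that finite_subset[OF S\<Omega>(2) fin\<Omega>] by (auto simp: card_gt_0_iff)
      \<comment> \<open>A nonempty \<open>S2\<close> forces \<open>c > 0\<close>, so the subtraction
        is not truncated.\<close>
      then have c: "real (c - 1) = real c - 1" using S(10) by (cases c) auto
      have "r e \<le> exp (\<theta> * (real a - potential n a (real (k + 1)) (real (c - 1)) - \<rho> * real t))"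
        unfolding r_def \<Omega>_def Q_def
        by (rule Suc.IH[OF st2[OF that] ka]) (use ins that S\<Omega> in blast)
      also have "\<dots> \<le> B * exp (- (\<theta> * (\<delta>1 - \<delta>3)))"
        unfolding c by (rule B) (use incr(2) in \<open>simp add: add.commute\<close>)
      finally show ?thesis .
    qed
    have r3: "r e \<le> B * exp (- (\<theta> * \<delta>3))" if "e \<in> S3" for e
    proof -
      have "r e \<le> exp (\<theta> * (real a - potential n a (real k) (real (c + 1)) - \<rho> * real t))"
        unfolding r_def \<Omega>_def Q_def
        by (rule Suc.IH[OF st3[OF that] Suc.prems(2)]) (use ins that S\<Omega> in blast)
      also have "\<dots> \<le> B * exp (- (\<theta> * \<delta>3))" by (rule B) (use incr(3) in \<open>simp add: add.commute\<close>)
      finally show ?thesis .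
    qed
    have r0: "r e \<le> B" if "e \<in> \<Omega>" for e
      unfolding r_def \<Omega>_def Q_def B_def
      by (rule Suc.IH[OF cherry_state_mono[OF Suc.prems(1) subset_insertI] Suc.prems(2) ins[OF that]])
    define T where "T = real (card \<Omega>)"
    have T: "T = n * (n - 1) / 2" by (simp add: T_def \<Omega>_def n_def real_choose_2)
    have n20: "n \<ge> 20"
    proof -
      have "1 / n \<le> (2 * d + 1) / n" using n0 d by (simp add: divide_right_mono)
      then have "1 / n \<le> 1 / 20" using d by linarith
      then show ?thesis using n0 by (simp add: divide_simps)
    qed
    have T0: "T > 0" unfolding T using n20 by simp
    define p1 p2 p3 where "p1 = real (card S1) / T" and "p2 = real (card S2) / T"
      and "p3 = real (card S3) / T"
    have p1: "p1 = f * (f - 1) / (n * (n - 1))"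
      unfolding p1_def S(9) real_choose_2 T f_def[symmetric] by simp
    have p2: "p2 = 4 * f * c / (n * (n - 1))"
      unfolding p2_def S(10) T of_nat_mult f_def[symmetric] by simp
    have p3: "p3 = 4 * f * (real k - real c) / (n * (n - 1))"
      unfolding p3_def S(11) T of_nat_mult f_def[symmetric] of_nat_diff[OF S(1)] by simp
    have "failure_prob \<Omega> Q (Suc t) E \<le> sum r \<Omega> / T"
      unfolding T_def r_def by (rule failure_prob_le_replacement[OF fin\<Omega> E\<Omega>]) (use up in auto)
    also have "sum r \<Omega> / T \<le> (card S1 * (B * exp (- (\<theta> * \<delta>1))) + card S2 * (B * exp (- (\<theta> * (\<delta>1 - \<delta>3))))
        + card S3 * (B * exp (- (\<theta> * \<delta>3))) + (real (card \<Omega>) - card S1 - card S2 - card S3) * B) / T"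
      using T0
      by (intro divide_right_mono sum_le_three_parts[OF fin\<Omega> S\<Omega> S(6-8) r1 r2 r3 r0]) auto
    also have "\<dots> = B * (p1 * exp (- (\<theta> * \<delta>1)) + p2 * exp (- (\<theta> * (\<delta>1 - \<delta>3)))
        + p3 * exp (- (\<theta> * \<delta>3)) + (1 - p1 - p2 - p3))"
      unfolding p1_def p2_def p3_def T_def[symmetric] using T0 by (simp add: field_simps)
    also have "\<dots> \<le> B * exp (- (\<theta> * ((1 - 5 * \<zeta>) / 4 - 4 * \<theta>)))"
    proof (intro mult_left_mono exp_step_bound)
      have "card (S1 \<union> S2 \<union> S3) \<le> card \<Omega>" using S\<Omega> fin\<Omega> by (intro card_mono) auto
      moreover have "card (S1 \<union> S2 \<union> S3) = card S1 + card S2 + card S3"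
        using S(6-8) finite_subset[OF S\<Omega>(1) fin\<Omega>] finite_subset[OF S\<Omega>(2) fin\<Omega>]
          finite_subset[OF S\<Omega>(3) fin\<Omega>]
        by (subst card_Un_disjoint, auto, subst card_Un_disjoint, auto)
      ultimately have "real (card S1) + real (card S2) + real (card S3) \<le> T"
        unfolding T_def by linarith
      then show "p1 + p2 + p3 \<le> 1"
        using T0 by (simp add: p1_def p2_def p3_def add_divide_distrib[symmetric])
      show "(1 - 5 * \<zeta>) / 4 \<le> p1 * \<delta>1 + p2 * (\<delta>1 - \<delta>3) + p3 * \<delta>3"
        unfolding p1 p2 p3 by (rule drift(1)[OF \<zeta>20])
      show "0 \<le> B" by (simp add: B_def)
    qed (use drift(2-7)[OF \<zeta>20] \<theta> T0 in \<open>auto simp: p1_def p2_def p3_def\<close>)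
    also have "(1 - 5 * \<zeta>) / 4 - 4 * \<theta> = \<rho>" by (simp add: \<rho>_def \<zeta>_def)
    also have "B * exp (- (\<theta> * \<rho>)) = exp (\<theta> * (real a - potential n a k c - \<rho> * real (Suc t)))"
      unfolding B_def mult_exp_exp by (simp add: algebra_simps)
    finally show ?thesis
      by (simp only: \<Omega>_def Q_def)
  qed
qed

section \<open>Maximum matchings and augmenting paths\<close>

lemma edge_ends:
  assumes "E \<subseteq> nsets W 2" "{x, y} \<in> E"
  shows "x \<noteq> y" "x \<in> W" "y \<in> W"
proof -
  have "{x, y} \<in> nsets W 2" using assms by (rule subsetD)
  then show "x \<noteq> y" "x \<in> W" "y \<in> W" by simp_all
qed

definition nbrs :: "'a set set \<Rightarrow> 'a \<Rightarrow> 'a set" where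
  "nbrs E v = {w. {v, w} \<in> E}"

lemma nbrs_subset:
  assumes "E \<subseteq> nsets W 2"
  shows "nbrs E v \<subseteq> W"
  using edge_ends(3)[OF assms] by (auto simp: nbrs_def)

lemma nbrs_sym: "w \<in> nbrs E v \<longleftrightarrow> v \<in> nbrs E w"
  by (simp add: nbrs_def insert_commute)

lemma card_nbrs:
  assumes "E \<subseteq> nsets V 2"
  shows "card (nbrs E v) = vertex_degree E v"
proof -
  have "{e \<in> E. v \<in> e} = (\<lambda>w. {v, w}) ` nbrs E v"
  proof
    show "(\<lambda>w. {v, w}) ` nbrs E v \<subseteq> {e \<in> E. v \<in> e}" by (auto simp: nbrs_def)
    show "{e \<in> E. v \<in> e} \<subseteq> (\<lambda>w. {v, w}) ` nbrs E v"
    proof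
      fix e assume e: "e \<in> {e \<in> E. v \<in> e}"
      then have "e \<in> nsets V 2" using assms by blast
      then obtain x y where xy: "e = {x, y}" by (auto simp: nsets_2_eq)
      then obtain w where "e = {v, w}" using e by (auto simp: insert_commute)
      then show "e \<in> (\<lambda>w. {v, w}) ` nbrs E v" using e by (auto simp: nbrs_def)
    qed
  qed
  moreover have "inj_on (\<lambda>w. {v, w}) (nbrs E v)" by (auto simp: inj_on_def doubleton_eq_iff)
  ultimately show ?thesis by (simp add: vertex_degree_def card_image)
qed

definition max_matching :: "'a set set \<Rightarrow> 'a set set \<Rightarrow> bool" where
  "max_matching E M \<longleftrightarrow> matching E M \<and> (\<forall>N. matching E N \<longrightarrow> card N \<le> card M)"

lemma max_matching_exists:
  assumes "finite E"
  obtains M where "max_matching E M"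
proof -
  have "matching E {}" by (simp add: matching_def)
  moreover have "\<forall>N. matching E N \<longrightarrow> card N < Suc (card E)"
    using assms by (auto simp: matching_def less_Suc_eq_le intro: card_mono)
  ultimately obtain M where "matching E M" "\<forall>N. matching E N \<longrightarrow> card N \<le> card M"
    using ex_has_greatest_nat[of "matching E" "{}" card "Suc (card E)"] by auto
  then show ?thesis using that by (auto simp: max_matching_def)
qed

text \<open>There is no augmenting path with one, three or five edges.\<close>

lemma max_matching_no_augment:
  assumes fin: "finite W" and E: "E \<subseteq> nsets W 2" and M: "max_matching E M"
    and u: "u \<notin> \<Union>M" and v: "v \<notin> \<Union>M" and uv: "u \<noteq> v"
  shows "{u, w} \<in> E \<Longrightarrow> w \<in> \<Union>M"
    and "{p', p} \<in> M \<Longrightarrow> {u, p'} \<in> E \<Longrightarrow> {v, p} \<in> E \<Longrightarrow> False"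
    and "{p', p} \<in> M \<Longrightarrow> {q', q} \<in> M \<Longrightarrow> {p', p} \<noteq> {q', q} \<Longrightarrow>
      {u, p'} \<in> E \<Longrightarrow> {v, q'} \<in> E \<Longrightarrow> {p, q} \<in> E \<Longrightarrow> False"
proof -
  have mat: "matching E M" and mx: "\<And>N. matching E N \<Longrightarrow> card N \<le> card M"
    using M by (auto simp: max_matching_def)
  have finM: "finite M" using finite_matching[OF fin E mat] .
  have ne: "x \<noteq> y" if "{x, y} \<in> E" for x y using edge_ends(1)[OF E that] .
  have MEdge: "x \<noteq> y" if "{x, y} \<in> M" for x y using ne mat that by (auto simp: matching_def)
  show "w \<in> \<Union>M" if "{u, w} \<in> E"
  proof (rule ccontr)
    assume w: "w \<notin> \<Union>M"
    have "matching E (insert {u, w} M)"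
      by (rule matching_insert[OF mat that]) (use u w in auto)
    moreover have "{u, w} \<notin> M" using u by auto
    ultimately show False using mx[of "insert {u, w} M"] finM by simp
  qed
  show False if e: "{p', p} \<in> M" and up: "{u, p'} \<in> E" and vp: "{v, p} \<in> E"
  proof -
    define N where "N = M - {{p', p}}"
    have N: "matching E N" by (rule matching_subset[OF mat]) (auto simp: N_def)
    have NU: "\<Union>N \<subseteq> \<Union>M" by (auto simp: N_def)
    have pN: "p \<notin> \<Union>N" "p' \<notin> \<Union>N"
      using matching_same_edge[OF mat e] by (auto simp: N_def)
    have pM: "p \<in> \<Union>M" "p' \<in> \<Union>M" "p \<noteq> p'" using e MEdge by auto
    have 1: "matching E (insert {u, p'} N)"
      by (rule matching_insert[OF N up]) (use u NU pN in auto)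
    have 2: "matching E (insert {v, p} (insert {u, p'} N))"
      by (rule matching_insert[OF 1 vp]) (use u v NU pN pM uv in auto)
    have "{u, p'} \<notin> N" "{v, p} \<notin> insert {u, p'} N"
      using u v NU uv pM by (auto simp: doubleton_eq_iff)
    moreover have "finite N" "card N = card M - 1" "card M > 0"
      using finM e by (auto simp: N_def card_gt_0_iff)
    ultimately show False using mx[OF 2] by simp
  qed
  show False if e: "{p', p} \<in> M" and f: "{q', q} \<in> M" and ef: "{p', p} \<noteq> {q', q}"
    and up: "{u, p'} \<in> E" and vq: "{v, q'} \<in> E" and pq: "{p, q} \<in> E"
  proof -
    define N where "N = M - {{p', p}, {q', q}}"
    have N: "matching E N" by (rule matching_subset[OF mat]) (auto simp: N_def)
    have NU: "\<Union>N \<subseteq> \<Union>M" by (auto simp: N_def)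
    have pN: "p \<notin> \<Union>N" "p' \<notin> \<Union>N" "q \<notin> \<Union>N" "q' \<notin> \<Union>N"
      using matching_same_edge[OF mat e] matching_same_edge[OF mat f] by (auto simp: N_def)
    have pM: "p \<in> \<Union>M" "p' \<in> \<Union>M" "p \<noteq> p'" "q \<in> \<Union>M" "q' \<in> \<Union>M" "q \<noteq> q'"
      using e f MEdge by auto
    have dj: "p \<noteq> q" "p \<noteq> q'" "p' \<noteq> q" "p' \<noteq> q'"
      using matching_same_edge[OF mat e f] ef by auto
    have 1: "matching E (insert {u, p'} N)"
      by (rule matching_insert[OF N up]) (use u NU pN in auto)
    have 2: "matching E (insert {v, q'} (insert {u, p'} N))"
      by (rule matching_insert[OF 1 vq]) (use u v NU pN pM uv dj in auto)
    have 3: "matching E (insert {p, q} (insert {v, q'} (insert {u, p'} N)))"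
      by (rule matching_insert[OF 2 pq]) (use u v NU pN pM uv dj in auto)
    have "{u, p'} \<notin> N" "{v, q'} \<notin> insert {u, p'} N"
      "{p, q} \<notin> insert {v, q'} (insert {u, p'} N)"
      using u v NU uv pM pN dj by (auto simp: doubleton_eq_iff)
    moreover have "finite N" using finM by (auto simp: N_def)
    moreover have "card N = card M - 2"
      using finM e f ef by (simp add: N_def card_Diff_subset)
    moreover have "card M \<ge> 2"
      using card_mono[OF finM, of "{{p', p}, {q', q}}"] e f ef by simp
    ultimately show False using mx[OF 3] by simp
  qed
qed

text \<open>\<open>P\<close> and \<open>Q\<close> consist of the mates of the neighbours. An edge
  \<open>{p, q}\<close> would close the augmenting path \<open>u, p', p, q, q', v\<close>, or
  \<open>u, p', p, v\<close> if both matching edges coincide. The last two conclusions record that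
  the sets are reached in two steps, which determines their side in a bipartite graph.\<close>

lemma max_matching_unjoined_sets:
  assumes fin: "finite W" and E: "E \<subseteq> nsets W 2" and M: "max_matching E M"
    and u: "u \<notin> \<Union>M" and v: "v \<notin> \<Union>M" and uv: "u \<noteq> v"
  obtains P Q where "P \<subseteq> W" "Q \<subseteq> W" "card P = card (nbrs E u)" "card Q = card (nbrs E v)"
    "\<And>p q. p \<in> P \<Longrightarrow> q \<in> Q \<Longrightarrow> {p, q} \<notin> E"
    "\<And>p. p \<in> P \<Longrightarrow> \<exists>p'\<in>nbrs E u. {p', p} \<in> E" "\<And>q. q \<in> Q \<Longrightarrow> \<exists>q'\<in>nbrs E v. {q', q} \<in> E"
proof -
  have mat: "matching E M" using M by (auto simp: max_matching_def)
  have ME: "M \<subseteq> E" using mat by (simp add: matching_def)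
  have ex: "\<exists>x. {w, x} \<in> M" if "w \<in> \<Union>M" for w
  proof -
    obtain e where e: "e \<in> M" "w \<in> e" using \<open>w \<in> \<Union>M\<close> by blast
    then have "e \<in> nsets W 2" using ME E by blast
    then obtain x y where "e = {x, y}" by (auto simp: nsets_2_eq)
    then show ?thesis using e by (auto simp: insert_commute)
  qed
  define mate where "mate w = (SOME x. {w, x} \<in> M)" for w
  have mate: "{w, mate w} \<in> M" if "w \<in> \<Union>M" for w
    unfolding mate_def using someI_ex[OF ex[OF that]] .
  have inj: "inj_on mate (\<Union>M)"
  proof (rule inj_onI)
    fix x y assume xy: "x \<in> \<Union>M" "y \<in> \<Union>M" "mate x = mate y"
    then have "{x, mate x} = {y, mate y}"
      using matching_same_edge[OF mat mate[OF xy(1)] mate[OF xy(2)], of "mate x"] by simp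
    then show "x = y" using xy(3) by (auto simp: doubleton_eq_iff)
  qed
  have N1: "nbrs E u \<subseteq> \<Union>M"
    using max_matching_no_augment(1)[OF fin E M u v uv] by (auto simp: nbrs_def)
  have N2: "nbrs E v \<subseteq> \<Union>M"
    using max_matching_no_augment(1)[OF fin E M v u] uv by (auto simp: nbrs_def)
  have sub: "\<Union>M \<subseteq> W" using Union_matching_subset[OF E mat] .
  have mateW: "mate w \<in> W" if "w \<in> \<Union>M" for w using mate[OF that] sub by blast
  show thesis
  proof (rule that[of "mate ` nbrs E u" "mate ` nbrs E v"])
    show "mate ` nbrs E u \<subseteq> W" "mate ` nbrs E v \<subseteq> W" using N1 N2 mateW by blast+
    show "card (mate ` nbrs E u) = card (nbrs E u)" "card (mate ` nbrs E v) = card (nbrs E v)"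
      using N1 N2 inj by (auto intro!: card_image intro: inj_on_subset)
    show "\<exists>p'\<in>nbrs E u. {p', p} \<in> E" if "p \<in> mate ` nbrs E u" for p
      using that N1 mate ME by blast
    show "\<exists>q'\<in>nbrs E v. {q', q} \<in> E" if "q \<in> mate ` nbrs E v" for q
      using that N2 mate ME by blast
    fix p q assume "p \<in> mate ` nbrs E u" "q \<in> mate ` nbrs E v"
    then obtain p' q' where pq': "p = mate p'" "p' \<in> nbrs E u" "q = mate q'" "q' \<in> nbrs E v"
      by blast
    then have p': "p = mate p'" "{u, p'} \<in> E" "p' \<in> \<Union>M"
      and q': "q = mate q'" "{v, q'} \<in> E" "q' \<in> \<Union>M"
      using subsetD[OF N1 pq'(2)] subsetD[OF N2 pq'(4)] by (auto simp: nbrs_def)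
    have pe: "{p', p} \<in> M" "{q', q} \<in> M" using mate p' q' by auto
    show "{p, q} \<notin> E"
    proof
      assume pq: "{p, q} \<in> E"
      then have "p \<noteq> q" by (rule edge_ends(1)[OF E])
      show False
      proof (cases "{p', p} = {q', q}")
        case True
        then have "q' = p" using \<open>p \<noteq> q\<close> by (auto simp: doubleton_eq_iff)
        then show False using max_matching_no_augment(2)[OF fin E M u v uv pe(1) p'(2)] q'(2) by simp
      next
        case False
        then show False
          using max_matching_no_augment(3)[OF fin E M u v uv pe False p'(2) q'(2) pq] by simp
      qed
    qed
  qed
qed

lemma perfect_matching_iff: "perfect_matching V E M \<longleftrightarrow> matching E M \<and> 2 * card M = card V"
  by (simp add: perfect_matching_def matching_def)

lemma perfect_matching_mono: "perfect_matching V E M \<Longrightarrow> E \<subseteq> E' \<Longrightarrow> perfect_matching V E' M"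
  by (auto simp: perfect_matching_def)

lemma unmatched_pair:
  assumes fin: "finite W" and E: "E \<subseteq> nsets W 2" and M: "matching E M"
    and ev: "even (card W)" and np: "\<not> perfect_matching W E M"
  obtains u v where "u \<in> W" "v \<in> W" "u \<notin> \<Union>M" "v \<notin> \<Union>M" "u \<noteq> v"
proof -
  have sub: "\<Union>M \<subseteq> W" using Union_matching_subset[OF E M] .
  have c: "card (\<Union>M) = 2 * card M" using card_Union_matching[OF E M] .
  have "card (\<Union>M) \<le> card W" using sub fin by (rule card_mono[rotated])
  moreover have "card (\<Union>M) \<noteq> card W" using c np M by (auto simp: perfect_matching_iff)
  ultimately have "card (W - \<Union>M) \<ge> 2"
    using c ev card_Diff_subset[OF finite_subset[OF sub fin] sub] by presburger
  then obtain T where T: "T \<subseteq> W - \<Union>M" "card T = 2" by (rule obtain_subset_with_card_n)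
  then obtain u v where "T = {u, v}" "u \<noteq> v" by (auto simp: card_2_iff)
  then have "u \<in> W - \<Union>M" "v \<in> W - \<Union>M" "u \<noteq> v" using T by auto
  then show ?thesis using that by blast
qed

text \<open>Two unmatched vertices would give unjoined sets of size at least \<open>K\<close>. As
  \<open>X\<close> and \<open>Y\<close> may coincide, the hypothesis also excludes large independent
  sets, hence nearly bipartite graphs.\<close>

lemma robust_perfect_matching:
  assumes fin: "finite W" and E: "E \<subseteq> nsets W 2" and ev: "even (card W)"
    and deg: "\<And>v. v \<in> W \<Longrightarrow> K \<le> real (card (nbrs E v))"
    and joined: "\<And>X Y. X \<subseteq> W \<Longrightarrow> Y \<subseteq> W \<Longrightarrow> K \<le> real (card X) \<Longrightarrow> K \<le> real (card Y) \<Longrightarrow>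
      \<exists>x\<in>X. \<exists>y\<in>Y. {x, y} \<in> E"
  shows "\<exists>M. perfect_matching W E M"
proof (rule ccontr)
  assume no: "\<not> ?thesis"
  obtain M where M: "max_matching E M"
    using max_matching_exists finite_subset[OF E finite_imp_finite_nsets[OF fin]] by blast
  then have "matching E M" by (simp add: max_matching_def)
  then obtain u v where uv: "u \<in> W" "v \<in> W" "u \<notin> \<Union>M" "v \<notin> \<Union>M" "u \<noteq> v"
    using unmatched_pair[OF fin E _ ev] no by blast
  obtain P Q where PQ: "P \<subseteq> W" "Q \<subseteq> W" "card P = card (nbrs E u)" "card Q = card (nbrs E v)"
    and no_edge: "\<And>p q. p \<in> P \<Longrightarrow> q \<in> Q \<Longrightarrow> {p, q} \<notin> E"
    by (rule max_matching_unjoined_sets[OF fin E M uv(3-5)]) (rule that)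
  have "\<exists>x\<in>P. \<exists>y\<in>Q. {x, y} \<in> E"
    by (rule joined[OF PQ(1,2)]) (use deg[OF uv(1)] deg[OF uv(2)] PQ(3,4) in simp_all)
  then show False using no_edge by blast
qed

lemma matching_cross_card:
  assumes "matching (cross_pairs A B) M" "A \<inter> B = {}" "A \<subseteq> \<Union>M" "finite M"
  shows "card A \<le> card M"
proof -
  have "\<forall>a\<in>A. \<exists>e. a \<in> e \<and> e \<in> M" using assms(3) by blast
  from bchoice[OF this] obtain g where g: "\<And>a. a \<in> A \<Longrightarrow> a \<in> g a \<and> g a \<in> M" by auto
  have "inj_on g A"
  proof (rule inj_onI)
    fix a b assume ab: "a \<in> A" "b \<in> A" "g a = g b"
    then have "g a \<in> cross_pairs A B" using g assms(1) by (auto simp: matching_def)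
    then show "a = b" using g[OF ab(1)] g[OF ab(2)] ab assms(2) by (auto simp: cross_pairs_def)
  qed
  then show ?thesis using g assms(4) by (intro card_inj_on_le[of g]) auto
qed

lemma cross_pairs_commute: "cross_pairs A B = cross_pairs B A"
  by (auto simp: cross_pairs_def image_iff insert_commute)

text \<open>With balanced sides, a matching that is not perfect misses a vertex on each side. Two
  steps lead back to the side of the start, so the two unjoined sets lie on opposite sides and
  joinedness across is enough.\<close>

lemma robust_bipartite_perfect_matching:
  assumes fin: "finite A" "finite B" and AB: "A \<inter> B = {}" and E: "E \<subseteq> cross_pairs A B"
    and card: "card A = card B"
    and deg: "\<And>v. v \<in> A \<union> B \<Longrightarrow> K \<le> real (card (nbrs E v))"
    and joined: "\<And>X Y. X \<subseteq> A \<Longrightarrow> Y \<subseteq> B \<Longrightarrow> K \<le> real (card X) \<Longrightarrow> K \<le> real (card Y) \<Longrightarrow>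
      \<exists>x\<in>X. \<exists>y\<in>Y. {x, y} \<in> E"
  shows "\<exists>M. perfect_matching (A \<union> B) E M"
proof (rule ccontr)
  assume no: "\<not> ?thesis"
  have EW: "E \<subseteq> nsets (A \<union> B) 2" using cross_pairs_subset_nsets[OF AB, of "A \<union> B"] E by auto
  have finW: "finite (A \<union> B)" using fin by simp
  have cW: "card (A \<union> B) = 2 * card A" using fin AB card by (simp add: card_Un_disjoint)
  obtain M where M: "max_matching E M"
    using max_matching_exists finite_subset[OF EW finite_imp_finite_nsets[OF finW]] by blast
  then have mat: "matching E M" by (simp add: max_matching_def)
  have finM: "finite M" using finite_matching[OF finW EW mat] .
  have "2 * card M \<le> 2 * card A"
    using card_Union_matching[OF EW mat] card_mono[OF finW Union_matching_subset[OF EW mat]] cW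
    by simp
  then have lt: "card M < card A"
    using no mat cW by (cases "card M = card A") (auto simp: perfect_matching_iff)
  have "\<not> A \<subseteq> \<Union>M"
    using matching_cross_card[OF matching_mono[OF mat E] AB _ finM] lt by auto
  then obtain a where a: "a \<in> A" "a \<notin> \<Union>M" by blast
  have "\<not> B \<subseteq> \<Union>M"
    using matching_cross_card[of B A M] matching_mono[OF mat E] AB finM lt card
    by (auto simp: cross_pairs_commute[of B A])
  then obtain b where b: "b \<in> B" "b \<notin> \<Union>M" by blast
  have abne: "a \<noteq> b" using a b AB by blast
  obtain P Q where PQ: "P \<subseteq> A \<union> B" "Q \<subseteq> A \<union> B" "card P = card (nbrs E a)" "card Q = card (nbrs E b)"
    and no_edge: "\<And>p q. p \<in> P \<Longrightarrow> q \<in> Q \<Longrightarrow> {p, q} \<notin> E"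
    and Pn: "\<And>p. p \<in> P \<Longrightarrow> \<exists>p'\<in>nbrs E a. {p', p} \<in> E"
    and Qn: "\<And>q. q \<in> Q \<Longrightarrow> \<exists>q'\<in>nbrs E b. {q', q} \<in> E"
    by (rule max_matching_unjoined_sets[OF finW EW M a(2) b(2) abne]) (rule that)
  have flip: "(x \<in> A \<and> y \<in> B) \<or> (x \<in> B \<and> y \<in> A)" if "{x, y} \<in> E" for x y
    using that E by (auto simp: cross_pairs_def doubleton_eq_iff dest!: subsetD)
  have "P \<subseteq> A"
  proof
    fix p assume "p \<in> P"
    then obtain p' where "{a, p'} \<in> E" "{p', p} \<in> E" using Pn by (auto simp: nbrs_def)
    then show "p \<in> A" using flip a AB by blast
  qed
  moreover have "Q \<subseteq> B"
  proof
    fix q assume "q \<in> Q"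
    then obtain q' where "{b, q'} \<in> E" "{q', q} \<in> E" using Qn by (auto simp: nbrs_def)
    then show "q \<in> B" using flip b AB by blast
  qed
  ultimately have "\<exists>x\<in>P. \<exists>y\<in>Q. {x, y} \<in> E"
    by (rule joined) (use deg[of a] deg[of b] a b PQ(3,4) in simp_all)
  then show False using no_edge by blast
qed

section \<open>Graphs of minimum degree close to half the order\<close>

lemma real_card_le_Int_plus:
  assumes "finite X" "finite T" "X \<subseteq> S \<union> T"
  shows "real (card X) \<le> real (card (X \<inter> S) + card T)"
proof -
  have "card X \<le> card ((X \<inter> S) \<union> T)" using assms by (intro card_mono) auto
  also have "\<dots> \<le> card (X \<inter> S) + card T" by (rule card_Un_le)
  finally show ?thesis by linarith
qed

lemma nbrs_Int_nsets: "v \<in> W \<Longrightarrow> E \<subseteq> nsets V 2 \<Longrightarrow> nbrs (E \<inter> nsets W 2) v = nbrs E v \<inter> W"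
  using edge_ends(1)[of E V] by (auto simp: nbrs_def)

lemma nbrs_Int_cross_pairs:
  assumes "A \<inter> B = {}" "v \<in> A"
  shows "nbrs (E \<inter> cross_pairs A B) v = nbrs E v \<inter> B"
  using assms by (auto simp: nbrs_def cross_pairs_def doubleton_eq_iff)

text \<open>The empty set is disjoint from itself and could lie in both matchings, whence the
  condition \<open>{} \<notin> E\<close>.\<close>

lemma card_matching_Un:
  assumes "matching E M" "matching E N" "\<Union>M \<inter> \<Union>N = {}" "finite M" "finite N" "{} \<notin> E"
  shows "matching E (M \<union> N)" "card (M \<union> N) = card M + card N"
proof -
  show "matching E (M \<union> N)" using assms(1-3) by (rule matching_Un)
  have "M \<inter> N = {}"
  proof -
    have False if "e \<in> M" "e \<in> N" for e
    proof -
      have "e \<noteq> {}" using that assms(1,6) by (auto simp: matching_def)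
      then show False using that assms(3) by blast
    qed
    then show ?thesis by blast
  qed
  then show "card (M \<union> N) = card M + card N" using assms(4,5) by (rule card_Un_disjoint[rotated 2])
qed

lemma double_count_le:
  assumes "finite A" "finite B" "\<And>a. a \<in> A \<Longrightarrow> d \<le> real (card {b \<in> B. R a b})"
    "\<And>b. b \<in> B \<Longrightarrow> real (card {a \<in> A. R a b}) \<le> D"
  shows "real (card A) * d \<le> real (card B) * D"
proof -
  have "real (card A) * d = (\<Sum>a\<in>A. d)" by simp
  also have "\<dots> \<le> (\<Sum>a\<in>A. real (card {b \<in> B. R a b}))" using assms(3) by (rule sum_mono)
  also have "\<dots> = real (\<Sum>a\<in>A. card {b \<in> B. R a b})" by simp
  also have "(\<Sum>a\<in>A. card {b \<in> B. R a b}) = (\<Sum>b\<in>B. card {a \<in> A. R a b})"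
    by (rule sum_multicount_gen) (use assms in auto)
  also have "real \<dots> = (\<Sum>b\<in>B. real (card {a \<in> A. R a b}))" by simp
  also have "\<dots> \<le> (\<Sum>b\<in>B. D)" using assms(4) by (rule sum_mono)
  finally show ?thesis by simp
qed

text \<open>The situation for a single graph, with the growth conditions on \<eta> replaced by
  \<open>1 \<le> \<eta> \<le> n / 1000\<close>. This leaves room for comparing small multiples of
  \<eta> with fixed fractions of \<open>n\<close>.\<close>

locale near_dirac =
  fixes V :: "'a set" and H :: "'a set set" and \<eta> :: real
  assumes finV: "finite V" and H: "H \<subseteq> nsets V 2" and even_V: "even (card V)"
    and degree: "\<And>v. v \<in> V \<Longrightarrow> real (card V) / 2 - \<eta> \<le> real (card (nbrs H v))"
    and eta1: "1 \<le> \<eta>" and eta: "\<eta> \<le> real (card V) / 1000"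
begin

abbreviation n :: real where "n \<equiv> real (card V)"

lemma n_ge: "n \<ge> 1000"
  using eta1 eta by simp

lemma nbrs_V: "nbrs H v \<subseteq> V"
  using nbrs_subset[OF H] .

lemma fin_sub: "X \<subseteq> V \<Longrightarrow> finite X"
  using finV finite_subset by blast

lemma real_card_Diff: "X \<subseteq> V \<Longrightarrow> real (card (V - X)) = n - real (card X)"
  using card_Diff_subset[OF fin_sub, of X] card_mono[OF finV, of X] by (simp add: of_nat_diff)

section \<open>Two nearly complete clusters\<close>

text \<open>A neighbourhood of a vertex of \<open>P\<close> lies in \<open>V - Q\<close>, which has
  at most \<open>n / 2 + \<eta>\<close> vertices, so it misses at most \<open>2 * \<eta>\<close> of
  them. Up to that many vertices of \<open>S\<close> lie outside \<open>P\<close>. Hence any two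
  sets of size \<open>n / 9\<close> in \<open>W\<close> are joined. Removing one vertex for parity
  is paid for by passing from \<open>n / 8\<close> to \<open>n / 9\<close>.\<close>

lemma cluster_perfect_matching:
  assumes PQ: "P \<subseteq> V" "Q \<subseteq> V" "n / 2 - \<eta> \<le> card P" "n / 2 - \<eta> \<le> card Q"
    and no_edge: "\<And>p q. p \<in> P \<Longrightarrow> q \<in> Q \<Longrightarrow> {p, q} \<notin> H"
    and S: "P \<subseteq> S" "S \<subseteq> V - Q" and degS: "\<And>v. v \<in> S \<Longrightarrow> n / 8 \<le> card (nbrs H v \<inter> S)"
    and W: "W \<subseteq> S" "card (S - W) \<le> 1" "even (card W)"
  shows "\<exists>M. perfect_matching W (H \<inter> nsets W 2) M"
proof (rule robust_perfect_matching[where K = "n / 9"])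
  have SV: "S \<subseteq> V" and WV: "W \<subseteq> V" using S W by auto
  have cVQ: "card (V - Q) \<le> n / 2 + \<eta>" using real_card_Diff[OF PQ(2)] PQ(4) by simp
  show "finite W" using fin_sub[OF WV] .
  show "H \<inter> nsets W 2 \<subseteq> nsets W 2" by blast
  show "even (card W)" by fact
  show "n / 9 \<le> card (nbrs (H \<inter> nsets W 2) v)" if v: "v \<in> W" for v
  proof -
    have "n / 8 \<le> card (nbrs H v \<inter> S)" using degS W v by blast
    also have "real (card (nbrs H v \<inter> S)) \<le> card ((nbrs H v \<inter> S) \<inter> W) + card (S - W)"
      by (rule real_card_le_Int_plus) (use fin_sub[OF SV] in auto)
    also have "(nbrs H v \<inter> S) \<inter> W = nbrs H v \<inter> W" using W by blast
    finally have "n / 8 - 1 \<le> card (nbrs H v \<inter> W)" using W(2) by linarith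
    then show ?thesis using n_ge nbrs_Int_nsets[OF v H] by simp
  qed
  show "\<exists>x\<in>X. \<exists>y\<in>Y. {x, y} \<in> H \<inter> nsets W 2"
    if X: "X \<subseteq> W" "n / 9 \<le> card X" and Y: "Y \<subseteq> W" "n / 9 \<le> card Y" for X Y
  proof -
    have c1: "card (V - Q - P) \<le> 2 * \<eta>"
    proof -
      have "P \<subseteq> V - Q" using S by blast
      then have "card (V - Q - P) = card (V - Q) - card P" "card P \<le> card (V - Q)"
        using card_Diff_subset[OF fin_sub[OF PQ(1)]] card_mono[of "V - Q" P] finV by auto
      then show ?thesis using cVQ PQ(3) by (simp add: of_nat_diff)
    qed
    have c2: "real (card Z) \<le> card (Z \<inter> P) + card (V - Q - P)" if "Z \<subseteq> W" for Z
      by (rule real_card_le_Int_plus) (use that W S WV fin_sub finV in auto)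
    have XP: "card (X \<inter> P) \<ge> n / 9 - 2 * \<eta>" using c1 c2[OF X(1)] X(2) by linarith
    have YP: "card (Y \<inter> P) \<ge> n / 9 - 2 * \<eta>" using c1 c2[OF Y(1)] Y(2) by linarith
    have "card (X \<inter> P) > 0" using XP eta n_ge by linarith
    then have "X \<inter> P \<noteq> {}" by auto
    then obtain x where x: "x \<in> X" "x \<in> P" by blast
    have "card (P - nbrs H x) \<le> 2 * \<eta>"
    proof -
      have sub: "nbrs H x \<subseteq> V - Q" using nbrs_V no_edge x by (auto simp: nbrs_def)
      have "card (P - nbrs H x) \<le> card ((V - Q) - nbrs H x)"
        by (rule card_mono) (use finV S in auto)
      also have "\<dots> = card (V - Q) - card (nbrs H x)"
        by (rule card_Diff_subset[OF fin_sub[OF nbrs_V] sub])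
      finally have "card (P - nbrs H x) \<le> card (V - Q) - card (nbrs H x)" .
      moreover have "card (nbrs H x) \<le> card (V - Q)" by (rule card_mono[OF _ sub]) (use finV in auto)
      ultimately have "real (card (P - nbrs H x)) \<le> card (V - Q) - real (card (nbrs H x))"
        by linarith
      then show ?thesis using cVQ degree[of x] x PQ(1) by auto
    qed
    moreover have "real (card (Y \<inter> P)) \<le> card ((Y \<inter> P) \<inter> nbrs H x) + card (P - nbrs H x)"
      by (rule real_card_le_Int_plus) (use fin_sub[OF PQ(1)] in auto)
    ultimately have "card ((Y \<inter> P) \<inter> nbrs H x) > 0" using YP eta n_ge by linarith
    then have "(Y \<inter> P) \<inter> nbrs H x \<noteq> {}" by auto
    then obtain y where y: "y \<in> Y" "{x, y} \<in> H" by (auto simp: nbrs_def)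
    moreover have "x \<noteq> y" using edge_ends(1)[OF H y(2)] .
    ultimately show ?thesis using x X Y by (intro bexI[of _ x] bexI[of _ y]) auto
  qed
qed

text \<open>The few leftover vertices join a cluster in which they have many neighbours: fewer than
  \<open>n / 8\<close> neighbours in \<open>P\<close> leave most of the degree for \<open>Q\<close>.
  Then parity is the only possible obstruction, and matching one edge across makes both remainders
  even.\<close>

lemma two_clusters:
  assumes PQ: "P \<subseteq> V" "Q \<subseteq> V" "P \<inter> Q = {}" "n / 2 - \<eta> \<le> card P" "n / 2 - \<eta> \<le> card Q"
    and no_edge: "\<And>p q. p \<in> P \<Longrightarrow> q \<in> Q \<Longrightarrow> {p, q} \<notin> H"
  shows "\<exists>S\<subseteq>V. n / 4 \<le> card S \<and> n / 4 \<le> card (V - S) \<and>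
    (\<forall>p\<in>S. \<forall>q\<in>V - S. \<exists>M. perfect_matching V (insert {p, q} H) M)"
proof -
  define L where "L = V - P - Q"
  have L: "card L \<le> 2 * \<eta>"
  proof -
    have "card (P \<union> Q) = card P + card Q" using PQ fin_sub by (intro card_Un_disjoint) auto
    moreover have "L = V - (P \<union> Q)" by (auto simp: L_def)
    ultimately show ?thesis using real_card_Diff[of "P \<union> Q"] PQ by simp
  qed
  define S where "S = P \<union> {l \<in> L. n / 8 \<le> card (nbrs H l \<inter> P)}"
  define S' where "S' = V - S"
  have S: "P \<subseteq> S" "S \<subseteq> V - Q" using PQ by (auto simp: S_def L_def)
  have S': "Q \<subseteq> S'" "S' \<subseteq> V - P" using PQ S by (auto simp: S'_def)
  have SV: "S \<subseteq> V" "S' \<subseteq> V" using S by (auto simp: S'_def)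
  have core: "n / 8 \<le> card (nbrs H v \<inter> A)" if "v \<in> A" "A \<subseteq> V" "nbrs H v \<subseteq> A \<union> L" for v A
  proof -
    have "real (card (nbrs H v)) \<le> card (nbrs H v \<inter> A) + card L"
      by (rule real_card_le_Int_plus) (use that fin_sub nbrs_V in \<open>auto simp: L_def\<close>)
    then show ?thesis using degree[of v] that L eta n_ge by auto
  qed
  have mono: "n / 8 \<le> card (nbrs H v \<inter> B)" if "n / 8 \<le> card (nbrs H v \<inter> A)" "A \<subseteq> B" for v A B
  proof -
    have "card (nbrs H v \<inter> A) \<le> card (nbrs H v \<inter> B)"
      by (rule card_mono) (use that fin_sub[OF nbrs_V] in auto)
    then show ?thesis using that(1) by linarith
  qed
  have degS: "n / 8 \<le> card (nbrs H v \<inter> S)" if v: "v \<in> S" for v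
  proof (rule mono[OF _ S(1)])
    show "n / 8 \<le> card (nbrs H v \<inter> P)"
    proof (cases "v \<in> P")
      case True
      then have "nbrs H v \<inter> Q = {}" using no_edge by (auto simp: nbrs_def)
      then have "nbrs H v \<subseteq> P \<union> L" using nbrs_V[of v] by (auto simp: L_def)
      then show ?thesis using core True PQ(1) by blast
    qed (use v in \<open>auto simp: S_def\<close>)
  qed
  have degS': "n / 8 \<le> card (nbrs H v \<inter> S')" if v: "v \<in> S'" for v
  proof (rule mono[OF _ S'(1)])
    show "n / 8 \<le> card (nbrs H v \<inter> Q)"
    proof (cases "v \<in> Q")
      case True
      then have "nbrs H v \<inter> P = {}" using no_edge by (auto simp: nbrs_def insert_commute)
      then have "nbrs H v \<subseteq> Q \<union> L" using nbrs_V[of v] by (auto simp: L_def)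
      then show ?thesis using core True PQ(2) by blast
    next
      case False
      then have vL: "card (nbrs H v \<inter> P) < n / 8" "v \<in> V" using v by (auto simp: S'_def S_def L_def)
      have "real (card (nbrs H v)) \<le> card (nbrs H v \<inter> Q) + card ((nbrs H v \<inter> P) \<union> L)"
        by (rule real_card_le_Int_plus) (use fin_sub nbrs_V in \<open>auto simp: L_def\<close>)
      moreover have "card ((nbrs H v \<inter> P) \<union> L) \<le> card (nbrs H v \<inter> P) + card L"
        by (rule card_Un_le)
      ultimately show ?thesis using degree[of v] vL L eta n_ge by linarith
    qed
  qed
  have no_edge': "{p, q} \<notin> H" if "p \<in> Q" "q \<in> P" for p q
    using no_edge[OF that(2,1)] by (simp add: insert_commute)
  have pm: "\<exists>M. perfect_matching W (H \<inter> nsets W 2) M"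
    if "W \<subseteq> S" "card (S - W) \<le> 1" "even (card W)" for W
    by (rule cluster_perfect_matching[OF PQ(1,2,4,5) _ S _ that]) (erule (1) no_edge, erule degS)
  have pm': "\<exists>M. perfect_matching W (H \<inter> nsets W 2) M"
    if "W \<subseteq> S'" "card (S' - W) \<le> 1" "even (card W)" for W
    by (rule cluster_perfect_matching[OF PQ(2,1,5,4) _ S' _ that]) (erule (1) no_edge', erule degS')
  have cV: "card V = card S + card S'"
    using card_Diff_subset[OF fin_sub[OF SV(1)] SV(1)] card_mono[OF finV SV(1)] by (simp add: S'_def)
  have combine: "\<exists>M. matching H M \<and> 2 * card M = card W + card W' \<and> \<Union>M \<subseteq> W \<union> W'"
    if W: "W \<subseteq> S" "card (S - W) \<le> 1" "even (card W)"
      and W': "W' \<subseteq> S'" "card (S' - W') \<le> 1" "even (card W')" for W W'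
  proof -
    obtain M M' where M: "perfect_matching W (H \<inter> nsets W 2) M"
      and M': "perfect_matching W' (H \<inter> nsets W' 2) M'"
      using pm[OF W] pm'[OF W'] by auto
    have mat: "matching (H \<inter> nsets W 2) M" "matching (H \<inter> nsets W' 2) M'"
      using M M' by (auto simp: perfect_matching_iff)
    have sub: "\<Union>M \<subseteq> W" "\<Union>M' \<subseteq> W'"
      using Union_matching_subset[OF Int_lower2 mat(1)] Union_matching_subset[OF Int_lower2 mat(2)] .
    have matH: "matching H M" "matching H M'"
      using matching_mono[OF mat(1) Int_lower1] matching_mono[OF mat(2) Int_lower1] .
    have dj: "\<Union>M \<inter> \<Union>M' = {}" using sub W(1) W'(1) by (auto simp: S'_def)
    have ne: "{} \<notin> H" using H by (auto simp: nsets_def)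
    note Un = card_matching_Un[OF matH dj finite_matching[OF finV H matH(1)]
        finite_matching[OF finV H matH(2)] ne]
    have "2 * card (M \<union> M') = card W + card W'"
      using Un(2) M M' by (simp add: perfect_matching_iff)
    then show ?thesis using Un(1) sub by (intro exI[of _ "M \<union> M'"]) auto
  qed
  have "\<exists>M. perfect_matching V (insert {p, q} H) M" if p: "p \<in> S" and q: "q \<in> V - S" for p q
  proof (cases "even (card S)")
    case True
    then have "even (card S')" using cV even_V by simp
    then obtain M where "matching H M" "2 * card M = card S + card S'"
      using combine[of S S'] True by auto
    then have "perfect_matching V H M" using cV by (simp add: perfect_matching_iff)
    then show ?thesis using perfect_matching_mono[of V H M] by blast
  next
    case False
    then have odd: "odd (card S')" using cV even_V by simp
    have q': "q \<in> S'" using q by (simp add: S'_def)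
    have c: "card (S - {p}) = card S - 1" "card (S' - {q}) = card S' - 1"
      using p q' fin_sub SV by auto
    have pos: "card S > 0" "card S' > 0" using False odd by (auto intro: Nat.gr0I)
    have 1: "S - (S - {p}) = {p}" "S' - (S' - {q}) = {q}" using p q' by auto
    obtain M where M: "matching H M" "2 * card M = card (S - {p}) + card (S' - {q})"
      "\<Union>M \<subseteq> (S - {p}) \<union> (S' - {q})"
      using combine[of "S - {p}" "S' - {q}"] c 1 False odd by auto
    have notM: "p \<notin> \<Union>M" "q \<notin> \<Union>M" using M(3) p q' by (auto simp: S'_def)
    have "matching (insert {p, q} H) (insert {p, q} M)"
      by (rule matching_insert[OF matching_mono[OF M(1)]]) (use notM in auto)
    moreover have "card (insert {p, q} M) = card M + 1"
      using notM finite_matching[OF finV H M(1)] by (subst card_insert_disjoint) auto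
    then have "2 * card (insert {p, q} M) = card V" using M(2) c cV pos by simp
    ultimately show ?thesis by (auto simp: perfect_matching_iff)
  qed
  moreover have "n / 4 \<le> card S"
  proof -
    have "card P \<le> card S" by (rule card_mono[OF fin_sub[OF SV(1)] S(1)])
    then show ?thesis using PQ(4) eta n_ge by linarith
  qed
  moreover have "n / 4 \<le> card (V - S)"
  proof -
    have "card Q \<le> card S'" by (rule card_mono[OF fin_sub[OF SV(2)] S'(1)])
    then show ?thesis using PQ(5) eta n_ge unfolding S'_def by linarith
  qed
  ultimately show ?thesis using SV(1) by blast
qed

section \<open>Nearly complete bipartite graphs\<close>

text \<open>Removing the \<open>2 * s\<close> ends of \<open>N\<close> from \<open>A\<close>
  balances the sides and costs at most \<open>18 * \<eta>\<close> neighbours per vertex, which gives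
  \<open>K\<close>. The allowances \<open>9 * \<eta>\<close> in the degrees and
  \<open>17 = 8 + 9\<close> in joinedness permit up to \<open>9 * \<eta>\<close> vertices to change
  sides beforehand.\<close>

lemma extend_to_perfect_matching:
  assumes AB: "A \<union> B = V" "A \<inter> B = {}" and cA: "card A = card B + 2 * s" and s: "real s \<le> 9 * \<eta>"
    and degA: "\<And>a. a \<in> A \<Longrightarrow> n / 20 - 9 * \<eta> \<le> card (nbrs H a \<inter> B)"
    and degB: "\<And>b. b \<in> B \<Longrightarrow> n / 20 - 9 * \<eta> \<le> card (nbrs H b \<inter> A)"
    and joined: "\<And>X Y. X \<subseteq> A \<Longrightarrow> Y \<subseteq> B \<Longrightarrow> 17 * \<eta> < card X \<Longrightarrow> 17 * \<eta> < card Y \<Longrightarrow>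
      \<exists>x\<in>X. \<exists>y\<in>Y. {x, y} \<in> H"
    and N: "matching (nsets A 2) N" "card N = s"
  shows "\<exists>M. perfect_matching V (H \<union> N) M"
proof -
  define A' where "A' = A - \<Union>N"
  define E where "E = H \<inter> cross_pairs A' B"
  have finA: "finite A" and finB: "finite B" using AB(1) finV by auto
  have NA: "\<Union>N \<subseteq> A" using Union_matching_subset[OF order_refl N(1)] .
  have cN: "card (\<Union>N) = 2 * s" using card_Union_matching[OF order_refl N(1)] N(2) by simp
  have A'B: "A' \<inter> B = {}" using AB by (auto simp: A'_def)
  have cA': "card A' = card B"
    using card_Diff_subset[OF finite_subset[OF NA finA] NA] cN cA by (simp add: A'_def)
  define K where "K = n / 20 - 27 * \<eta>"
  have K: "17 * \<eta> < K" using eta n_ge unfolding K_def by linarith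
  have "\<exists>M. perfect_matching (A' \<union> B) E M"
  proof (rule robust_bipartite_perfect_matching[where K = K])
    show "finite A'" "finite B" using finA finB by (auto simp: A'_def)
    show "A' \<inter> B = {}" "card A' = card B" by fact+
    show "E \<subseteq> cross_pairs A' B" by (auto simp: E_def)
    show "K \<le> card (nbrs E v)" if v: "v \<in> A' \<union> B" for v
    proof (cases "v \<in> A'")
      case True
      then have "nbrs E v = nbrs H v \<inter> B"
        unfolding E_def by (rule nbrs_Int_cross_pairs[OF A'B])
      moreover have "n / 20 - 9 * \<eta> \<le> card (nbrs H v \<inter> B)"
        using True by (intro degA) (auto simp: A'_def)
      ultimately show ?thesis using eta1 by (simp add: K_def)
    next
      case False
      then have vB: "v \<in> B" using v by blast
      then have eq: "nbrs E v = nbrs H v \<inter> A'"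
        unfolding E_def cross_pairs_commute[of A' B]
        by (intro nbrs_Int_cross_pairs) (use A'B in auto)
      have "real (card (nbrs H v \<inter> A)) \<le> card ((nbrs H v \<inter> A) \<inter> A') + card (\<Union>N)"
        by (rule real_card_le_Int_plus) (use finA finite_subset[OF NA finA] in \<open>auto simp: A'_def\<close>)
      also have "(nbrs H v \<inter> A) \<inter> A' = nbrs H v \<inter> A'" by (auto simp: A'_def)
      finally have "real (card (nbrs H v \<inter> A)) \<le> card (nbrs H v \<inter> A') + 2 * real s" by (simp add: cN)
      then show ?thesis using degB[OF vB] s unfolding eq K_def by linarith
    qed
    show "\<exists>x\<in>X. \<exists>y\<in>Y. {x, y} \<in> E" if "X \<subseteq> A'" "Y \<subseteq> B" "K \<le> card X" "K \<le> card Y" for X Y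
    proof -
      have "\<exists>x\<in>X. \<exists>y\<in>Y. {x, y} \<in> H"
        by (rule joined) (use that K in \<open>auto simp: A'_def\<close>)
      then obtain x y where xy: "x \<in> X" "y \<in> Y" "{x, y} \<in> H" by blast
      then have "{x, y} \<in> cross_pairs A' B" using that(1,2) by (auto simp: cross_pairs_def)
      then show ?thesis using xy by (auto simp: E_def)
    qed
  qed
  then obtain M where M: "matching E M" "2 * card M = card (A' \<union> B)"
    by (auto simp: perfect_matching_iff)
  have E_sub: "E \<subseteq> nsets (A' \<union> B) 2" using cross_pairs_subset_nsets[OF A'B, of "A' \<union> B"] by (auto simp: E_def)
  have UM: "\<Union>M \<subseteq> A' \<union> B" using Union_matching_subset[OF E_sub M(1)] .
  have mat: "matching (H \<union> N) M" by (rule matching_mono[OF M(1)]) (auto simp: E_def)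
  have matN: "matching (H \<union> N) N" using N(1) by (auto simp: matching_def)
  have NV: "N \<subseteq> nsets V 2" using N(1) nsets_mono[of A V 2] AB(1) by (auto simp: matching_def)
  have "{} \<notin> H \<union> N" using H NV by (auto simp: nsets_def)
  moreover have "\<Union>M \<inter> \<Union>N = {}" using UM NA AB(2) by (auto simp: A'_def)
  moreover have "finite M" "finite N"
    using finite_matching[OF finV _ mat] finite_matching[OF finV _ matN] H NV by auto
  ultimately have Un: "matching (H \<union> N) (M \<union> N)" "card (M \<union> N) = card M + card N"
    using card_matching_Un[OF mat matN] by blast+
  have "card (A' \<union> B) = 2 * card B"
    using finA finB A'B cA' by (subst card_Un_disjoint) (auto simp: A'_def)
  moreover have "card V = card A + card B"
    using AB finA finB card_Un_disjoint by metis
  ultimately have "2 * card (M \<union> N) = card V" using Un(2) M(2) N(2) cA by simp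
  then show ?thesis using Un(1) by (auto simp: perfect_matching_iff)
qed

text \<open>
  The slack \<open>2 * (\<eta> - a)\<close> accounts for the vertices of the larger side that are already covered by
  edges of \<open>H\<close> inside that side.
\<close>

definition completable :: "'a set \<Rightarrow> nat \<Rightarrow> bool" where
  "completable U a \<longleftrightarrow> U \<subseteq> V \<and> real a \<le> \<eta> \<and> n / 2 + a - 2 * (\<eta> - a) \<le> card U \<and>
     (\<forall>N. matching (nsets U 2) N \<longrightarrow> card N = a \<longrightarrow> (\<exists>M. perfect_matching V (H \<union> N) M))"

lemma completable_perfect:
  assumes "perfect_matching V H M"
  shows "\<exists>U a. completable U a"
proof (intro exI)
  show "completable V 0"
    unfolding completable_def using eta1 n_ge perfect_matching_mono[OF assms Un_upper1] by auto
qed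

text \<open>Every vertex missed by a maximum matching \<open>R\<close> has all its neighbours within
  \<open>A\<close> covered by \<open>R\<close>. If \<open>R\<close> had fewer than
  \<open>2 * \<delta>\<close> edges, its ends would receive fewer than
  \<open>\<delta> * n / 5\<close> such edges, so fewer than \<open>n / 5\<close> vertices would be
  missed; but almost all of the \<open>n / 2\<close> vertices are.\<close>

lemma matching_of_min_degree:
  assumes A: "A \<subseteq> V" "n / 2 \<le> card A" and \<delta>: "real \<delta> \<le> 10 * \<eta>"
    and lo: "\<And>v. v \<in> A \<Longrightarrow> \<delta> \<le> card (nbrs H v \<inter> A)"
    and hi: "\<And>v. v \<in> A \<Longrightarrow> card (nbrs H v \<inter> A) \<le> n / 20"
  shows "\<exists>R. matching (H \<inter> nsets A 2) R \<and> card R = 2 * \<delta>"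
proof -
  let ?E = "H \<inter> nsets A 2"
  have finA: "finite A" using fin_sub[OF A(1)] .
  obtain R where R: "max_matching ?E R"
    using max_matching_exists[of ?E] finite_imp_finite_nsets[OF finA, of 2] by blast
  then have mat: "matching ?E R" by (simp add: max_matching_def)
  have UR: "\<Union>R \<subseteq> A" using Union_matching_subset[OF Int_lower2 mat] .
  have cR: "card (\<Union>R) = 2 * card R" using card_Union_matching[OF Int_lower2 mat] .
  have finR: "finite R" using finite_matching[OF finA Int_lower2 mat] .
  have "2 * \<delta> \<le> card R"
  proof (rule ccontr)
    assume "\<not> 2 * \<delta> \<le> card R"
    then have lt: "card R < 2 * \<delta>" by simp
    have "real (card (A - \<Union>R)) * \<delta> \<le> real (card (\<Union>R)) * (n / 20)"
    proof (rule double_count_le[where R = "\<lambda>a b. b \<in> nbrs H a"])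
      show "finite (A - \<Union>R)" "finite (\<Union>R)" using finA finite_subset[OF UR finA] by auto
    next
      fix a assume a: "a \<in> A - \<Union>R"
      have "w \<in> \<Union>R" if w: "w \<in> nbrs H a \<inter> A" for w
      proof (rule ccontr)
        assume nw: "w \<notin> \<Union>R"
        have aw: "{a, w} \<in> H" using w by (auto simp: nbrs_def)
        then have "{a, w} \<in> ?E" using a w edge_ends(1)[OF H aw] by auto
        then have "matching ?E (insert {a, w} R)"
          by (rule matching_insert[OF mat]) (use a nw in auto)
        moreover have "{a, w} \<notin> R" using a by auto
        ultimately show False using R finR by (auto simp: max_matching_def dest!: spec[of _ "insert {a, w} R"])
      qed
      then have "nbrs H a \<inter> A \<subseteq> {b \<in> \<Union>R. b \<in> nbrs H a}" by blast
      then have "card (nbrs H a \<inter> A) \<le> card {b \<in> \<Union>R. b \<in> nbrs H a}"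
        by (rule card_mono[rotated]) (rule finite_subset[OF _ finite_subset[OF UR finA]], auto)
      then show "real \<delta> \<le> card {b \<in> \<Union>R. b \<in> nbrs H a}" using lo[of a] a by simp
    next
      fix b assume b: "b \<in> \<Union>R"
      have "card {a \<in> A - \<Union>R. b \<in> nbrs H a} \<le> card (nbrs H b \<inter> A)"
        by (rule card_mono) (use finA nbrs_sym[of b H] in auto)
      then show "card {a \<in> A - \<Union>R. b \<in> nbrs H a} \<le> n / 20" using hi[of b] b UR by force
    qed
    moreover have "real (card (A - \<Union>R)) = real (card A) - 2 * real (card R)"
      using card_Diff_subset[OF finite_subset[OF UR finA] UR] card_mono[OF finA UR] cR
      by (simp add: of_nat_diff)
    moreover have "real (card R) < 2 * real \<delta>" using lt by linarith
    ultimately have "(real (card A) - 2 * real (card R)) * \<delta> \<le> 2 * real (card R) * (n / 20)"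
      using cR by simp
    also have "\<dots> < 2 * (2 * real \<delta>) * (n / 20)"
      using \<open>real (card R) < 2 * real \<delta>\<close> n_ge by (intro mult_strict_right_mono mult_strict_left_mono) auto
    also have "\<dots> = (n / 5) * \<delta>" by simp
    finally have "real (card A) - 2 * real (card R) < n / 5"
      by (rule mult_right_less_imp_less) simp
    then show False using A(2) \<open>real (card R) < 2 * real \<delta>\<close> \<delta> eta n_ge by linarith
  qed
  then obtain R' where "R' \<subseteq> R" "card R' = 2 * \<delta>" by (rule obtain_subset_with_card_n)
  then show ?thesis using matching_subset[OF mat] by blast
qed

lemma completable_unbalanced:
  assumes AB: "A \<union> B = V" "A \<inter> B = {}" and le: "card B \<le> card A" and cA: "card A \<le> n / 2 + 9 * \<eta>"
    and degA: "\<And>a. a \<in> A \<Longrightarrow> n / 8 \<le> card (nbrs H a \<inter> B)"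
    and degB: "\<And>b. b \<in> B \<Longrightarrow> n / 8 \<le> card (nbrs H b \<inter> A)"
    and joined: "\<And>X Y. X \<subseteq> A \<Longrightarrow> Y \<subseteq> B \<Longrightarrow> 8 * \<eta> < card X \<Longrightarrow> 8 * \<eta> < card Y \<Longrightarrow>
      \<exists>x\<in>X. \<exists>y\<in>Y. {x, y} \<in> H"
  shows "\<exists>U a. completable U a"
proof -
  have finA: "finite A" and finB: "finite B" using AB(1) finV by auto
  have cV: "card V = card A + card B"
    using card_Un_disjoint[OF finA finB AB(2)] AB(1) by simp
  define s where "s = (card A - card B) div 2"
  have "even (card A - card B)" using cV even_V le by simp
  then have s: "card A = card B + 2 * s" using le by (simp add: s_def)
  have rs: "real (card A) = n / 2 + s" using s cV by simp
  have s9: "real s \<le> 9 * \<eta>" using rs cA by simp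
  \<comment> \<open>These vertices have enough neighbours in \<open>A\<close> to change sides. Each
    change lowers the difference of the sizes by two and saves one matching edge; changing all of
    them also bounds the degrees inside what is left of \<open>A\<close>.\<close>
  define Y0 where "Y0 = {v \<in> A. n / 20 \<le> card (nbrs H v \<inter> A)}"
  have move: "\<exists>M. perfect_matching V (H \<union> N) M"
    if Z: "Z \<subseteq> Y0" "card Z \<le> s" and N: "matching (nsets (A - Z) 2) N" "card N = s - card Z" for Z N
  proof (rule extend_to_perfect_matching[of "A - Z" "B \<union> Z" "s - card Z"])
    have ZA: "Z \<subseteq> A" using Z(1) by (auto simp: Y0_def)
    have finZ: "finite Z" using finite_subset[OF ZA finA] .
    have Z9: "real (card Z) \<le> 9 * \<eta>" using Z(2) s9 by linarith
    show "A - Z \<union> (B \<union> Z) = V" "(A - Z) \<inter> (B \<union> Z) = {}" using AB ZA by auto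
    have "card (B \<union> Z) = card B + card Z" using finB finZ AB(2) ZA by (intro card_Un_disjoint) auto
    moreover have "card (A - Z) = card A - card Z" using card_Diff_subset[OF finZ ZA] .
    ultimately show "card (A - Z) = card (B \<union> Z) + 2 * (s - card Z)" using s Z(2) by simp
    show "real (s - card Z) \<le> 9 * \<eta>" using s9 by linarith
    show "matching (nsets (A - Z) 2) N" "card N = s - card Z" by fact+
    show "n / 20 - 9 * \<eta> \<le> card (nbrs H a \<inter> (B \<union> Z))" if "a \<in> A - Z" for a
    proof -
      have "card (nbrs H a \<inter> B) \<le> card (nbrs H a \<inter> (B \<union> Z))"
        by (rule card_mono) (use finB finZ in auto)
      then show ?thesis using degA[of a] that n_ge eta1 by force
    qed
    show "n / 20 - 9 * \<eta> \<le> card (nbrs H b \<inter> (A - Z))" if b: "b \<in> B \<union> Z" for b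
    proof -
      have "n / 20 \<le> card (nbrs H b \<inter> A)"
      proof (cases "b \<in> B")
        case True
        then show ?thesis using degB[OF True] n_ge by simp
      next
        case False
        then show ?thesis using b Z(1) by (auto simp: Y0_def)
      qed
      moreover have "real (card (nbrs H b \<inter> A)) \<le> card ((nbrs H b \<inter> A) \<inter> (A - Z)) + card Z"
        by (rule real_card_le_Int_plus) (use finA finZ in auto)
      moreover have "(nbrs H b \<inter> A) \<inter> (A - Z) = nbrs H b \<inter> (A - Z)" by auto
      ultimately show ?thesis using Z9 by simp
    qed
    show "\<exists>x\<in>X. \<exists>y\<in>Y. {x, y} \<in> H"
      if X: "X \<subseteq> A - Z" "17 * \<eta> < card X" and Y: "Y \<subseteq> B \<union> Z" "17 * \<eta> < card Y" for X Y
    proof -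
      have finY: "finite Y" using finite_subset[OF Y(1)] finB finZ by simp
      have "real (card Y) \<le> card (Y \<inter> B) + card Z"
        by (rule real_card_le_Int_plus[OF finY finZ Y(1)])
      then have "8 * \<eta> < card (Y \<inter> B)" using Y(2) Z9 by simp
      moreover have "8 * \<eta> < card X" using X(2) eta1 by simp
      ultimately have "\<exists>x\<in>X. \<exists>y\<in>Y \<inter> B. {x, y} \<in> H" using X(1) by (intro joined) auto
      then show ?thesis by blast
    qed
  qed
  show ?thesis
  proof (cases "s \<le> card Y0")
    case True
    then obtain Z where Z: "Z \<subseteq> Y0" "card Z = s" by (rule obtain_subset_with_card_n)
    have "\<exists>M. perfect_matching V (H \<union> {}) M"
      by (rule move[OF Z(1)]) (use Z(2) in \<open>auto simp: matching_def\<close>)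
    then show ?thesis using completable_perfect by auto
  next
    case False
    define A' where "A' = A - Y0"
    define s' where "s' = s - card Y0"
    have YA: "Y0 \<subseteq> A" by (auto simp: Y0_def)
    have finY0: "finite Y0" using finite_subset[OF YA finA] .
    have A'V: "A' \<subseteq> V" using AB by (auto simp: A'_def)
    have finA': "finite A'" using finA by (simp add: A'_def)
    have complete: "\<exists>M. perfect_matching V (H \<union> N) M"
      if "matching (nsets A' 2) N" "card N = s'" for N
      using move[of Y0 N] False that by (simp add: A'_def s'_def)
    have cA': "real (card A') = n / 2 + s'"
      using card_Diff_subset[OF finY0 YA] card_mono[OF finA YA] False rs
      by (simp add: A'_def s'_def of_nat_diff)
    show ?thesis
    proof (cases "real s' \<le> \<eta>")
      case True
      then have "completable A' s'" unfolding completable_def using A'V cA' complete by auto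
      then show ?thesis by blast
    next
      case s'_gt: False
      \<comment> \<open>A vertex of \<open>A'\<close> has at most \<open>n / 2 - s'\<close>
        neighbours outside \<open>A'\<close>, hence at least \<open>s' - \<eta>\<close>
        inside.\<close>
      define \<delta> where "\<delta> = nat \<lceil>real s' - \<eta>\<rceil>"
      have \<delta>: "real s' - \<eta> \<le> \<delta>" "\<delta> \<le> real s' - \<eta> + 1" using s'_gt by (auto simp: \<delta>_def; linarith)+
      have s'9: "real s' \<le> 9 * \<eta>" using s9 by (simp add: s'_def)
      have lo: "\<delta> \<le> card (nbrs H v \<inter> A')" if v: "v \<in> A'" for v
      proof -
        have "real (card (nbrs H v)) \<le> card (nbrs H v \<inter> A') + card (V - A')"
          by (rule real_card_le_Int_plus) (use fin_sub[OF nbrs_V] nbrs_V finV in auto)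
        then have "real s' - \<eta> \<le> card (nbrs H v \<inter> A')"
          using degree[of v] v A'V real_card_Diff[OF A'V] cA' by auto
        then show ?thesis unfolding \<delta>_def by (simp add: nat_ceiling_le_eq)
      qed
      have hi: "card (nbrs H v \<inter> A') \<le> n / 20" if v: "v \<in> A'" for v
      proof -
        have "card (nbrs H v \<inter> A') \<le> card (nbrs H v \<inter> A)"
          by (rule card_mono) (use finA in \<open>auto simp: A'_def\<close>)
        moreover have "card (nbrs H v \<inter> A) < n / 20" using v by (auto simp: A'_def Y0_def)
        ultimately show ?thesis by linarith
      qed
      have "\<exists>R. matching (H \<inter> nsets A' 2) R \<and> card R = 2 * \<delta>"
        by (rule matching_of_min_degree[OF A'V _ _ lo hi]) (use cA' \<delta> s'9 eta1 in auto)
      then obtain R where R: "matching (H \<inter> nsets A' 2) R" "card R = 2 * \<delta>" by blast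
      have RH: "R \<subseteq> H" using R(1) by (auto simp: matching_def)
      have matR: "matching (nsets A' 2) R" using matching_mono[OF R(1) Int_lower2] .
      show ?thesis
      proof (cases "s' \<le> 2 * \<delta>")
        case True
        then obtain R' where R': "R' \<subseteq> R" "card R' = s'"
          using obtain_subset_with_card_n[of s' R] R(2) by auto
        have "\<exists>M. perfect_matching V (H \<union> R') M"
          by (rule complete[OF matching_subset[OF matR R'(1)] R'(2)])
        moreover have "H \<union> R' = H" using R'(1) RH by blast
        ultimately show ?thesis using completable_perfect by auto
      next
        case gt: False
        define U where "U = A' - \<Union>R"
        \<comment> \<open>\<open>R\<close> supplies \<open>2 * \<delta>\<close> edges and covers
          \<open>4 * \<delta>\<close> vertices, so \<open>U\<close> has
          \<open>n / 2 + a - 2 * \<delta>\<close> vertices. Since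
          \<open>\<delta> \<ge> s' - \<eta>\<close> amounts to
          \<open>\<delta> \<le> \<eta> - a\<close>, this is within the slack.\<close>
        define a where "a = s' - 2 * \<delta>"
        have UR: "\<Union>R \<subseteq> A'" using Union_matching_subset[OF order_refl matR] .
        have ra: "real a = real s' - 2 * real \<delta>" using gt by (simp add: a_def of_nat_diff)
        have "card (\<Union>R) = 4 * \<delta>" using card_Union_matching[OF order_refl matR] R(2) by simp
        then have cU: "real (card U) = n / 2 + s' - 4 * real \<delta>"
          using card_Diff_subset[OF finite_subset[OF UR finA'] UR] card_mono[OF finA' UR] cA'
          by (simp add: U_def of_nat_diff)
        have "\<exists>M. perfect_matching V (H \<union> N) M" if N: "matching (nsets U 2) N" "card N = a" for N
        proof -
          have UA': "U \<subseteq> A'" by (auto simp: U_def)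
          have matN: "matching (nsets A' 2) N"
            by (rule matching_mono[OF N(1) nsets_mono[OF UA']])
          have "\<Union>N \<subseteq> U" using Union_matching_subset[OF order_refl N(1)] .
          then have dj: "\<Union>N \<inter> \<Union>R = {}" by (auto simp: U_def)
          have "{} \<notin> nsets A' 2" by (auto simp: nsets_def)
          note Un = card_matching_Un[OF matN matR dj finite_matching[OF finA' order_refl matN]
              finite_matching[OF finA' order_refl matR] this]
          have "\<exists>M. perfect_matching V (H \<union> (N \<union> R)) M"
            by (rule complete[OF Un(1)]) (use Un(2) N(2) R(2) gt in \<open>simp add: a_def\<close>)
          moreover have "H \<union> (N \<union> R) = H \<union> N" using RH by blast
          ultimately show ?thesis by simp
        qed
        moreover have "U \<subseteq> V" using A'V by (auto simp: U_def)
        moreover have "real a \<le> \<eta>" using ra \<delta> s'_gt by linarith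
        moreover have "3 * real a - 2 * \<eta> \<le> real s' - 4 * real \<delta>" using ra \<delta> by linarith
        then have "n / 2 + a - 2 * (\<eta> - a) \<le> card U" unfolding cU by (simp add: algebra_simps)
        ultimately have "completable U a" unfolding completable_def by blast
        then show ?thesis by blast
      qed
    qed
  qed
qed

text \<open>Each vertex of \<open>I\<close> misses at most \<open>4 * \<eta>\<close> vertices
  outside \<open>I\<close>. Double counting bounds by \<open>8 * \<eta>\<close> the set
  \<open>J\<close> of outside vertices with few neighbours in \<open>I\<close>; these are added to
  \<open>I\<close>, as their neighbours lie mostly on the other side. Either side may turn out to be
  the larger one.\<close>

lemma completable_independent:
  assumes I: "I \<subseteq> V" "n / 2 - 3 * \<eta> \<le> card I"
    and ind: "\<And>x y. x \<in> I \<Longrightarrow> y \<in> I \<Longrightarrow> {x, y} \<notin> H"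
  shows "\<exists>U a. completable U a"
proof -
  have finI: "finite I" using fin_sub[OF I(1)] .
  have cVI: "real (card (V - I)) = n - card I" using real_card_Diff[OF I(1)] .
  have nI: "nbrs H x \<subseteq> V - I" if "x \<in> I" for x
    using nbrs_V[of x] ind[OF that] by (auto simp: nbrs_def)
  have miss: "card (V - I - nbrs H x) \<le> 4 * \<eta>" if x: "x \<in> I" for x
  proof -
    have "card (V - I - nbrs H x) = card (V - I) - card (nbrs H x)"
      by (rule card_Diff_subset[OF fin_sub[OF nbrs_V] nI[OF x]])
    moreover have "card (nbrs H x) \<le> card (V - I)"
      by (rule card_mono[OF _ nI[OF x]]) (use finV in auto)
    ultimately have "real (card (V - I - nbrs H x)) = card (V - I) - real (card (nbrs H x))"
      by (simp add: of_nat_diff)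
    then show ?thesis using cVI I degree[of x] x by auto
  qed
  define J where "J = {b \<in> V - I. card (nbrs H b \<inter> I) < n / 8}"
  have JV: "J \<subseteq> V" "J \<inter> I = {}" by (auto simp: J_def)
  have finJ: "finite J" using fin_sub[OF JV(1)] .
  have cI: "n / 4 \<le> card I" using I(2) eta n_ge by linarith
  have J8: "card J \<le> 8 * \<eta>"
  proof -
    have "real (card J) * (card I - n / 8) \<le> real (card I) * (4 * \<eta>)"
    proof (rule double_count_le[where R = "\<lambda>b x. b \<notin> nbrs H x", OF finJ finI])
      fix b assume b: "b \<in> J"
      have "real (card I) \<le> card (I \<inter> {x. b \<notin> nbrs H x}) + card (nbrs H b \<inter> I)"
        by (rule real_card_le_Int_plus) (use finI nbrs_sym[of b H] in auto)
      moreover have "I \<inter> {x. b \<notin> nbrs H x} = {x \<in> I. b \<notin> nbrs H x}" by blast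
      ultimately show "card I - n / 8 \<le> card {x \<in> I. b \<notin> nbrs H x}" using b by (simp add: J_def)
    next
      fix x assume x: "x \<in> I"
      have "card {b \<in> J. b \<notin> nbrs H x} \<le> card (V - I - nbrs H x)"
        by (rule card_mono) (use finV in \<open>auto simp: J_def\<close>)
      then show "card {b \<in> J. b \<notin> nbrs H x} \<le> 4 * \<eta>" using miss[OF x] by linarith
    qed
    also have "\<dots> = real (card I) / 2 * (8 * \<eta>)" by simp
    also have "\<dots> \<le> (card I - n / 8) * (8 * \<eta>)" using cI eta1 by (intro mult_right_mono) auto
    finally have "(card I - n / 8) * card J \<le> (card I - n / 8) * (8 * \<eta>)" by (simp add: mult.commute)
    moreover have "0 < card I - n / 8" using cI n_ge by linarith
    ultimately show ?thesis by (simp only: mult_le_cancel_left_pos)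
  qed
  define A where "A = I \<union> J"
  define B where "B = V - A"
  have AB: "A \<union> B = V" "A \<inter> B = {}" using I(1) JV by (auto simp: A_def B_def)
  have AV: "A \<subseteq> V" and BV: "B \<subseteq> V" using AB by auto
  have cA: "real (card A) = card I + card J"
    unfolding A_def using card_Un_disjoint[OF finI finJ] JV(2) by (simp add: Int_commute)
  have cB: "real (card B) = n - card A" using real_card_Diff[OF AV] by (simp add: B_def)
  have I_le: "card I \<le> n / 2 + \<eta>"
  proof -
    have "card I > 0" using cI n_ge by linarith
    then have "I \<noteq> {}" by auto
    then obtain x where x: "x \<in> I" by blast
    have "card (nbrs H x) \<le> card (V - I)" by (rule card_mono[OF _ nI[OF x]]) (use finV in auto)
    then show ?thesis using degree[of x] x I(1) cVI by auto
  qed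
  have degA: "n / 8 \<le> card (nbrs H v \<inter> B)" if v: "v \<in> A" for v
  proof (cases "v \<in> I")
    case True
    have "real (card (nbrs H v)) \<le> card (nbrs H v \<inter> B) + card J"
      by (rule real_card_le_Int_plus) (use fin_sub[OF nbrs_V] finJ nI[OF True] in \<open>auto simp: A_def B_def\<close>)
    then show ?thesis using degree[of v] True I(1) J8 eta n_ge by auto
  next
    case False
    then have vJ: "v \<in> J" using v by (auto simp: A_def)
    have "real (card (nbrs H v)) \<le> card (nbrs H v \<inter> B) + card ((nbrs H v \<inter> I) \<union> J)"
      by (rule real_card_le_Int_plus)
        (use fin_sub[OF nbrs_V] nbrs_V[of v] finI finJ in \<open>auto simp: A_def B_def\<close>)
    moreover have "card ((nbrs H v \<inter> I) \<union> J) \<le> card (nbrs H v \<inter> I) + card J" by (rule card_Un_le)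
    moreover have "card (nbrs H v \<inter> I) < n / 8" "v \<in> V" using vJ by (auto simp: J_def)
    ultimately show ?thesis using degree[of v] J8 eta n_ge by linarith
  qed
  have degB: "n / 8 \<le> card (nbrs H v \<inter> A)" if v: "v \<in> B" for v
  proof -
    have "card (nbrs H v \<inter> I) \<le> card (nbrs H v \<inter> A)"
      by (rule card_mono) (use finI finJ in \<open>auto simp: A_def\<close>)
    moreover have "n / 8 \<le> card (nbrs H v \<inter> I)" using v by (auto simp: B_def A_def J_def)
    ultimately show ?thesis by linarith
  qed
  have joined: "\<exists>x\<in>X. \<exists>y\<in>Y. {x, y} \<in> H"
    if X: "X \<subseteq> A" "8 * \<eta> < card X" and Y: "Y \<subseteq> B" "8 * \<eta> < card Y" for X Y
  proof -
    have finX: "finite X" and finY: "finite Y"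
      using fin_sub[OF order_trans[OF X(1) AV]] fin_sub[OF order_trans[OF Y(1) BV]] .
    have "real (card X) \<le> card (X \<inter> I) + card J"
      by (rule real_card_le_Int_plus[OF finX finJ]) (use X(1) in \<open>auto simp: A_def\<close>)
    then have "0 < card (X \<inter> I)" using X(2) J8 by linarith
    then have "X \<inter> I \<noteq> {}" by auto
    then obtain x where x: "x \<in> X" "x \<in> I" by blast
    have "real (card Y) \<le> card (Y \<inter> nbrs H x) + card (V - I - nbrs H x)"
      by (rule real_card_le_Int_plus[OF finY]) (use Y(1) finV in \<open>auto simp: A_def B_def\<close>)
    then have "0 < card (Y \<inter> nbrs H x)" using Y(2) miss[OF x(2)] eta1 by linarith
    then have "Y \<inter> nbrs H x \<noteq> {}" by auto
    then show ?thesis using x by (auto simp: nbrs_def)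
  qed
  show ?thesis
  proof (cases "card B \<le> card A")
    case True
    show ?thesis
      by (rule completable_unbalanced[OF AB True _ degA degB joined]) (use cA I_le J8 in simp_all)
  next
    case False
    show ?thesis
    proof (rule completable_unbalanced[of B A])
      show "B \<union> A = V" "B \<inter> A = {}" using AB by auto
      show "card A \<le> card B" using False by simp
      show "card B \<le> n / 2 + 9 * \<eta>" using cB cA I(2) eta1 by linarith
      show "\<exists>x\<in>X. \<exists>y\<in>Y. {x, y} \<in> H"
        if XY: "X \<subseteq> B" "Y \<subseteq> A" "8 * \<eta> < card X" "8 * \<eta> < card Y" for X Y
      proof -
        obtain y x where "y \<in> Y" "x \<in> X" "{y, x} \<in> H" using joined[OF XY(2,4,1,3)] by blast
        then show ?thesis by (intro bexI[of _ x] bexI[of _ y]) (auto simp: insert_commute)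
      qed
    qed (use degA degB in auto)
  qed
qed

text \<open>The neighbourhood of a common vertex of \<open>P\<close> and \<open>Q\<close> avoids
  \<open>P \<union> Q\<close>, so the union has at most \<open>n / 2 + \<eta>\<close> vertices. The
  intersection is then large, and it is independent because no edge joins \<open>P\<close> to
  \<open>Q\<close>.\<close>

lemma completable_or_two_clusters:
  obtains U a where "completable U a"
  | S where "S \<subseteq> V" "n / 4 \<le> card S" "n / 4 \<le> card (V - S)"
      "\<And>p q. p \<in> S \<Longrightarrow> q \<in> V - S \<Longrightarrow> \<exists>M. perfect_matching V (insert {p, q} H) M"
proof (cases "\<exists>M. perfect_matching V H M")
  case True
  then show thesis using completable_perfect that(1) by blast
next
  case no: False
  obtain M where M: "max_matching H M"
    using max_matching_exists finite_subset[OF H finite_imp_finite_nsets[OF finV]] by blast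
  then have mat: "matching H M" by (simp add: max_matching_def)
  obtain u v where uv: "u \<in> V" "v \<in> V" "u \<notin> \<Union>M" "v \<notin> \<Union>M" "u \<noteq> v"
    using unmatched_pair[OF finV H mat even_V] no by blast
  obtain P Q where PQ: "P \<subseteq> V" "Q \<subseteq> V" "card P = card (nbrs H u)" "card Q = card (nbrs H v)"
    and no_edge: "\<And>p q. p \<in> P \<Longrightarrow> q \<in> Q \<Longrightarrow> {p, q} \<notin> H"
    by (rule max_matching_unjoined_sets[OF finV H M uv(3-5)]) (rule that)
  have cPQ: "n / 2 - \<eta> \<le> card P" "n / 2 - \<eta> \<le> card Q"
    using PQ(3,4) degree[OF uv(1)] degree[OF uv(2)] by simp_all
  show thesis
  proof (cases "P \<inter> Q = {}")
    case True
    show thesis using two_clusters[OF PQ(1,2) True cPQ no_edge] that(2) by blast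
  next
    case False
    then obtain p where p: "p \<in> P" "p \<in> Q" by blast
    have "nbrs H p \<subseteq> V - (P \<union> Q)"
    proof
      fix w assume w: "w \<in> nbrs H p"
      then have "{p, w} \<in> H" "{w, p} \<in> H" by (auto simp: nbrs_def insert_commute)
      then have "w \<notin> P" "w \<notin> Q" using no_edge p by blast+
      then show "w \<in> V - (P \<union> Q)" using nbrs_V w by blast
    qed
    then have "card (nbrs H p) \<le> card (V - (P \<union> Q))" by (rule card_mono[rotated]) (use finV in auto)
    moreover have "real (card (V - (P \<union> Q))) = n - card (P \<union> Q)"
      using real_card_Diff[of "P \<union> Q"] PQ by simp
    moreover have "p \<in> V" using p PQ by blast
    ultimately have "card (P \<union> Q) \<le> n / 2 + \<eta>" using degree[of p] by linarith
    moreover have "card P + card Q = card (P \<union> Q) + card (P \<inter> Q)"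
      using PQ fin_sub by (intro card_Un_Int) auto
    ultimately have "n / 2 - 3 * \<eta> \<le> card (P \<inter> Q)" using cPQ by linarith
    then show thesis using completable_independent[of "P \<inter> Q"] PQ no_edge that(1) by blast
  qed
qed

end

section \<open>The probability of a perfect matching\<close>

text \<open>Sides of size at least \<open>n / 4\<close> have at least \<open>3 / 16 * n^2\<close>
  pairs across, which is at least 3/8 of all pairs.\<close>

lemma failure_prob_cross_edge_le:
  assumes finV: "finite V" and V0: "card V \<ge> 2" and S: "S \<subseteq> V"
    and cS: "real (card V) / 4 \<le> card S" "real (card V) / 4 \<le> card (V - S)"
  defines "Q \<equiv> \<lambda>E. E \<inter> cross_pairs S (V - S) \<noteq> {}"
  assumes "E \<subseteq> nsets V 2"
  shows "failure_prob (nsets V 2) Q t E \<le> (5/8) ^ t"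
  using assms(7)
proof (induction t arbitrary: E)
  case (Suc t)
  define \<Omega> where "\<Omega> = nsets V 2"
  define X where "X = cross_pairs S (V - S)"
  define T where "T = real (card \<Omega>)"
  define n where "n = real (card V)"
  define s where "s = real (card S)"
  have fin\<Omega>: "finite \<Omega>" using finV by (simp add: \<Omega>_def finite_imp_finite_nsets)
  have E: "E \<subseteq> \<Omega>" using Suc.prems by (simp add: \<Omega>_def)
  have up: "Q (insert e E)" if "Q E" for e E using that by (auto simp: Q_def)
  have X: "X \<subseteq> \<Omega>" unfolding X_def \<Omega>_def by (rule cross_pairs_subset_nsets) (use S in auto)
  have T: "T = n * (n - 1) / 2" by (simp add: T_def \<Omega>_def n_def real_choose_2)
  have n2: "n \<ge> 2" using V0 by (simp add: n_def)
  have T0: "T > 0" using n2 by (simp add: T)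
  have cVS: "real (card (V - S)) = n - s"
    using card_Diff_subset[OF finite_subset[OF S finV] S] card_mono[OF finV S]
    by (simp add: n_def s_def of_nat_diff)
  have cX: "real (card X) = s * (n - s)"
    unfolding X_def using card_cross_pairs[of S "V - S"] cVS by (simp add: s_def)
  have "0 \<le> (s - n / 4) * (3 * n / 4 - s)"
    using cS cVS by (intro mult_nonneg_nonneg) (auto simp: s_def n_def)
  then have "3 / 16 * (n * n) \<le> real (card X)"
    unfolding cX by (simp add: field_simps)
  moreover have "T \<le> n * n / 2" using n2 by (simp add: T)
  ultimately have X_ge: "3 / 8 * T \<le> real (card X)" by simp
  have r0: "failure_prob \<Omega> Q t (insert e E) = 0" if "e \<in> X" for e
    by (rule failure_prob_success[OF fin\<Omega>]) (use that E X up in \<open>auto simp: Q_def X_def\<close>)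
  have "failure_prob \<Omega> Q (Suc t) E \<le> (\<Sum>e\<in>\<Omega>. failure_prob \<Omega> Q t (insert e E)) / T"
    unfolding T_def by (rule failure_prob_le_replacement[OF fin\<Omega> E]) (use up in auto)
  also have "(\<Sum>e\<in>\<Omega>. failure_prob \<Omega> Q t (insert e E))
      = (\<Sum>e\<in>\<Omega> - X. failure_prob \<Omega> Q t (insert e E))"
    using r0 X fin\<Omega> by (intro sum.mono_neutral_right) auto
  also have "\<dots> / T \<le> (real (card (\<Omega> - X)) * (5/8) ^ t) / T"
  proof (intro divide_right_mono sum_bounded_above)
    show "failure_prob \<Omega> Q t (insert e E) \<le> (5/8) ^ t" if "e \<in> \<Omega> - X" for e
      unfolding \<Omega>_def by (rule Suc.IH) (use that E in \<open>auto simp: \<Omega>_def\<close>)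
  qed (use T0 in simp)
  also have "\<dots> \<le> (5/8 * T * (5/8) ^ t) / T"
  proof (intro divide_right_mono mult_right_mono)
    show "real (card (\<Omega> - X)) \<le> 5/8 * T"
      using card_Diff_subset[OF finite_subset[OF X fin\<Omega>] X] card_mono[OF fin\<Omega> X] X_ge
      by (simp add: T_def of_nat_diff)
  qed (use T0 in auto)
  also have "\<dots> = (5/8) ^ Suc t" using T0 by simp
  finally show ?case by (simp only: \<Omega>_def)
qed simp

context near_dirac
begin

lemma failure_prob_completable_le:
  assumes U: "completable U a" and K: "0 \<le> K" "K\<^sup>2 \<le> \<eta>" and m: "real m \<ge> 4 * \<eta> + K * sqrt \<eta>"
  shows "failure_prob (nsets V 2) (has_matching U a) m {} \<le> exp (25 - K / 4)"
proof -
  define r where "r = sqrt \<eta>"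
  have r: "r * r = \<eta>" "1 \<le> r" using eta1 by (auto simp: r_def)
  have "K \<le> r" using K real_le_rsqrt by (simp add: r_def)
  then have Kr: "K * r \<le> \<eta>" using r mult_right_mono[of K r r] by simp
  \<comment> \<open>Stopping after \<open>l\<close> draws keeps the losses proportional to the
    number of draws under control: \<open>K^2 \<le> \<eta>\<close> gives
    \<open>l \<le> 6 * \<eta>\<close>.\<close>
  define l where "l = nat \<lceil>4 * \<eta> + K * r\<rceil>"
  have l: "4 * \<eta> + K * r \<le> l" "l \<le> 4 * \<eta> + K * r + 1" and lm: "l \<le> m"
  proof -
    have "0 \<le> 4 * \<eta> + K * r" using K r eta1 by simp
    then show "4 * \<eta> + K * r \<le> l" "l \<le> 4 * \<eta> + K * r + 1" unfolding l_def by linarith+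
    show "l \<le> m" using m by (simp add: l_def r_def nat_ceiling_le_eq)
  qed
  have l6: "real l \<le> 6 * \<eta>" using l Kr eta1 by linarith
  define d where "d = \<eta> - real a"
  \<comment> \<open>This choice makes the second-order loss \<open>4 * \<theta> * l\<close> of order
    \<open>sqrt \<eta>\<close>, the same as the surplus \<open>K * sqrt \<eta> / 4\<close>, so that
    a large \<open>K\<close> wins.\<close>
  define \<theta> where "\<theta> = 1 / r"
  define \<zeta> where "\<zeta> = (2 * d + 1) / n"
  define \<rho> where "\<rho> = (1 - 5 * \<zeta>) / 4 - 4 * \<theta>"
  have UV: "U \<subseteq> V" and a: "real a \<le> \<eta>" and cU: "n / 2 + a - 2 * d \<le> card U"
    using U by (auto simp: completable_def d_def)
  have d: "0 \<le> d" "d \<le> \<eta>" using a by (auto simp: d_def)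
  have \<zeta>20: "\<zeta> \<le> 1/20" using d eta1 eta n_ge unfolding \<zeta>_def by (simp add: divide_simps)
  have "failure_prob (nsets V 2) (has_matching U a) m {} \<le> failure_prob (nsets V 2) (has_matching U a) l {}"
    by (rule failure_prob_antimono)
      (use finV lm has_matching_insert in \<open>auto simp: finite_imp_finite_nsets\<close>)
  also have "\<dots> \<le> exp (\<theta> * (real a - potential n a (real 0) (real 0) - \<rho> * real l))"
    unfolding \<rho>_def \<zeta>_def
    by (rule failure_prob_cherry_le[OF finV _ UV _ d(1) _ cU _ cherry_state_empty])
      (use n_ge a eta r \<zeta>20 in \<open>auto simp: \<theta>_def \<zeta>_def\<close>)
  also have "\<dots> \<le> exp (25 - K / 4)"
  proof -
    \<comment> \<open>The vertices missing from \<open>U\<close> cost at most \<open>d + 1\<close>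
      in the exponent before scaling by \<theta>, and \<open>a = \<eta> - d\<close> returns the
      \<open>d\<close>. Together with \<open>24 * r\<close>, the remaining 1 gives the constant 25,
      as \<open>r \<ge> 1\<close>.\<close>
    have "5/4 * \<zeta> * l \<le> d + 1"
    proof -
      have "\<zeta> * l \<le> \<zeta> * (6 * \<eta>)" using l6 d n_ge by (intro mult_left_mono) (auto simp: \<zeta>_def)
      also have "\<dots> \<le> \<zeta> * (6 * (n / 1000))" using eta d n_ge by (intro mult_left_mono) (auto simp: \<zeta>_def)
      also have "\<dots> = 6/1000 * (2 * d + 1)" using n_ge by (simp add: \<zeta>_def)
      finally show ?thesis using d by simp
    qed
    moreover have "4 * \<theta> * l \<le> 24 * r"
    proof -
      have "\<theta> * l \<le> \<theta> * (6 * \<eta>)" using l6 r by (intro mult_left_mono) (auto simp: \<theta>_def)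
      also have "\<dots> = 6 * r" using r by (simp add: \<theta>_def r(1)[symmetric])
      finally show ?thesis by simp
    qed
    moreover have "\<rho> * l = l / 4 - 5/4 * \<zeta> * l - 4 * \<theta> * l"
      by (simp add: \<rho>_def field_simps)
    ultimately have "a - \<rho> * l \<le> (25 - K / 4) * r"
      using l(1) r(2) unfolding d_def by (simp add: algebra_simps)
    then have "\<theta> * (a - \<rho> * l) \<le> \<theta> * ((25 - K / 4) * r)"
      using r by (intro mult_left_mono) (auto simp: \<theta>_def)
    also have "\<dots> = 25 - K / 4" using r by (simp add: \<theta>_def)
    finally show ?thesis by simp
  qed
  finally show ?thesis .
qed

lemma prob_perfect_matching_ge:
  assumes K: "0 \<le> K" "K\<^sup>2 \<le> \<eta>" and m: "real m \<ge> 4 * \<eta> + K * sqrt \<eta>" "m \<le> card V choose 2"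
  shows "measure_pmf.prob (uniform_random_graph V m) {G. \<exists>M. perfect_matching V (H \<union> G) M}
    \<ge> 1 - exp (25 - K / 4)"
proof (rule completable_or_two_clusters)
  fix U a assume U: "completable U a"
  have "measure_pmf.prob (uniform_random_graph V m) {G. \<exists>M. perfect_matching V (H \<union> G) M}
      \<ge> 1 - failure_prob (nsets V 2) (has_matching U a) m {}"
  proof (rule prob_uniform_random_graph_ge[OF finV m(2)])
    fix G assume "has_matching U a G"
    then obtain N where N: "matching (G \<inter> nsets U 2) N" "card N = a" by (auto simp: has_matching_def)
    have "matching (nsets U 2) N" using matching_mono[OF N(1) Int_lower2] .
    then obtain M where M: "perfect_matching V (H \<union> N) M"
      using U N(2) unfolding completable_def by blast
    have "N \<subseteq> G" using N(1) by (auto simp: matching_def)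
    then have "perfect_matching V (H \<union> G) M" by (intro perfect_matching_mono[OF M]) auto
    then show "G \<in> {G. \<exists>M. perfect_matching V (H \<union> G) M}" by blast
  qed
  then show ?thesis using failure_prob_completable_le[OF U K m(1)] by linarith
next
  fix S assume S: "S \<subseteq> V" "n / 4 \<le> card S" "n / 4 \<le> card (V - S)"
    and pm: "\<And>p q. p \<in> S \<Longrightarrow> q \<in> V - S \<Longrightarrow> \<exists>M. perfect_matching V (insert {p, q} H) M"
  define Q where "Q = (\<lambda>E. E \<inter> cross_pairs S (V - S) \<noteq> {})"
  have "measure_pmf.prob (uniform_random_graph V m) {G. \<exists>M. perfect_matching V (H \<union> G) M}
      \<ge> 1 - failure_prob (nsets V 2) Q m {}"
  proof (rule prob_uniform_random_graph_ge[OF finV m(2)])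
    fix G assume "Q G"
    then obtain p q where pq: "{p, q} \<in> G" "p \<in> S" "q \<in> V - S" by (auto simp: Q_def cross_pairs_def)
    then obtain M where "perfect_matching V (insert {p, q} H) M" using pm by blast
    then have "perfect_matching V (H \<union> G) M"
      by (rule perfect_matching_mono) (use pq in auto)
    then show "G \<in> {G. \<exists>M. perfect_matching V (H \<union> G) M}" by blast
  qed
  moreover have "failure_prob (nsets V 2) Q m {} \<le> (5/8) ^ m"
    unfolding Q_def by (rule failure_prob_cross_edge_le[OF finV _ S]) (use n_ge in auto)
  \<comment> \<open>The case of two clusters is far from critical: \<open>m \<ge> K\<close> is
    enough here.\<close>
  moreover have "(5/8) ^ m \<le> exp (25 - K / 4)"
  proof -
    have "(5/8 :: real) \<le> exp (- 3/8)" using exp_ge_add_one_self[of "- 3/8 :: real"] by simp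
    then have "(5/8 :: real) ^ m \<le> exp (- 3/8) ^ m" by (rule power_mono) simp
    also have "\<dots> = exp (real m * (- 3/8))" by (rule exp_of_nat_mult[symmetric])
    also have "\<dots> \<le> exp (25 - K / 4)"
    proof -
      have "1 \<le> sqrt \<eta>" using eta1 by simp
      then have "K * 1 \<le> K * sqrt \<eta>" using K(1) by (rule mult_left_mono)
      then show ?thesis using m(1) eta1 K(1) by simp
    qed
    finally show ?thesis .
  qed
  ultimately show ?thesis by linarith
qed

end

theorem theorem2p5:
  fixes V :: "nat \<Rightarrow> 'a set"
    and H :: "nat \<Rightarrow> 'a set set"
    and \<eta> lam :: "nat \<Rightarrow> real"
    and m :: "nat \<Rightarrow> nat"
  assumes "\<And>n. even n \<Longrightarrow> card (V n) = n"
    and "\<And>n. even n \<Longrightarrow> simple_graph (V n) (H n)"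
    and "\<forall>\<^sub>F n in even_at_top. real (min_degree (V n) (H n)) \<ge> real n / 2 - \<eta> n"
    and "\<forall>\<^sub>F n in even_at_top. \<eta> n \<ge> 0"
    and "\<eta> \<in> o[even_at_top](\<lambda>n. real n)"
    and "\<eta> \<in> \<omega>[even_at_top](\<lambda>_. 1)"
    and "\<forall>\<^sub>F n in even_at_top. lam n \<ge> 0"
    and "lam \<in> \<omega>[even_at_top](\<lambda>n. sqrt (\<eta> n))"
    and "\<forall>\<^sub>F n in even_at_top. m n \<in> {1..n choose 2}"
    and "\<forall>\<^sub>F n in even_at_top. real (m n) \<ge> 4 * \<eta> n + lam n"
  shows "((\<lambda>n. measure_pmf.prob (uniform_random_graph (V n) (m n))
            {G. \<exists>M. perfect_matching (V n) (H n \<union> G) M}) \<longlongrightarrow> 1) even_at_top"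
proof (rule tendstoI)
  fix \<epsilon> :: real assume \<epsilon>: "0 < \<epsilon>"
  \<comment> \<open>The number 26 exceeds 25 so that the error falls strictly below \<epsilon>. The
    maximum with 1 makes \<open>K^2 \<le> \<eta>\<close> imply
    \<open>1 \<le> \<eta>\<close>.\<close>
  define K where "K = max 1 (4 * (26 - ln \<epsilon>))"
  have "1 \<le> K" "4 * (26 - ln \<epsilon>) \<le> K" by (simp_all only: K_def max.cobounded1 max.cobounded2)
  then have K: "1 \<le> K" "25 - K / 4 < ln \<epsilon>" by simp_all
  have small: "exp (25 - K / 4) < \<epsilon>" using K(2) \<epsilon> by (metis exp_less_cancel_iff exp_ln)
  have "\<forall>\<^sub>F n in even_at_top. even n"
    by (simp add: even_at_top_def eventually_inf_principal)
  moreover have "\<forall>\<^sub>F n in even_at_top. norm (\<eta> n) \<le> 1/1000 * norm (real n)"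
    using assms(5) by (rule landau_o.smallD) simp
  moreover have "\<forall>\<^sub>F n in even_at_top. norm (\<eta> n) \<ge> K\<^sup>2 * norm (1::real)"
    using assms(6) by (rule landau_omega.smallD) (use K in simp)
  moreover have "\<forall>\<^sub>F n in even_at_top. norm (lam n) \<ge> K * norm (sqrt (\<eta> n))"
    using assms(8) by (rule landau_omega.smallD) (use K in simp)
  ultimately show "\<forall>\<^sub>F n in even_at_top. dist (measure_pmf.prob (uniform_random_graph (V n) (m n))
            {G. \<exists>M. perfect_matching (V n) (H n \<union> G) M}) 1 < \<epsilon>"
    using assms(3,4,7,9,10)
  proof eventually_elim
    case (elim n)
    have card: "card (V n) = n" and graph: "finite (V n)" "H n \<subseteq> nsets (V n) 2"
      using assms(1,2)[OF elim(1)] by (auto simp: simple_graph_def)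
    have K2: "K\<^sup>2 \<le> \<eta> n" using elim by simp
    have "1 \<le> K\<^sup>2" using K(1) by simp
    interpret near_dirac "V n" "H n" "\<eta> n"
    proof
      show "even (card (V n))" using elim(1) card by simp
      show "real (card (V n)) / 2 - \<eta> n \<le> card (nbrs (H n) v)" if "v \<in> V n" for v
      proof -
        have "min_degree (V n) (H n) \<le> vertex_degree (H n) v"
          unfolding min_degree_def using graph(1) that by (intro Min_le) auto
        then show ?thesis using elim card card_nbrs[OF graph(2)] by simp
      qed
      show "1 \<le> \<eta> n" using K2 \<open>1 \<le> K\<^sup>2\<close> by simp
      show "\<eta> n \<le> real (card (V n)) / 1000" using elim card by simp
    qed (use graph in auto)
    have "4 * \<eta> n + K * sqrt (\<eta> n) \<le> real (m n)" using elim by simp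
    moreover have "m n \<le> card (V n) choose 2" using elim card by simp
    ultimately have "1 - exp (25 - K / 4) \<le> measure_pmf.prob (uniform_random_graph (V n) (m n))
            {G. \<exists>M. perfect_matching (V n) (H n \<union> G) M}"
      using K(1) K2 by (intro prob_perfect_matching_ge) auto
    then show ?case
      using small measure_pmf.prob_le_1[of "uniform_random_graph (V n) (m n)"
          "{G. \<exists>M. perfect_matching (V n) (H n \<union> G) M}"]
      by (simp add: dist_real_def)
  qed
qed

end
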